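(* Let $N\ge 2$, let $\gamma>0$, and let $a,b,c\in\mathbb{R}$ satisfy either (A1) $0<b<\min\{a,c\}$ or (A2) $a,c>0$ and $b>\max\{a,c\}$. Let $\omega>\frac{\gamma^2}{N^2}$ satisfy $N\sqrt{\omega}-\gamma\le\frac{2\gamma}{N}$, and put $\alpha=\frac{2(b-c)}{b^2-ac}(N\sqrt\omega-\gamma)$, $\beta=\frac{2(b-a)}{b^2-ac}(N\sqrt\omega-\gamma)$. Then the set of ground states is $$\mathcal{G}(\alpha,\beta)=\left\{\left(e^{i\theta_1}\sqrt{\tfrac{b-c}{b^2-ac}}\,\Phi_{\omega,\gamma},\ e^{i\theta_2}\sqrt{\tfrac{b-a}{b^2-ac}}\,\Phi_{\omega,\gamma}\right):\ \theta_1,\theta_2\in\mathbb{R}\right\},$$ where $\Phi_{\omega,\gamma}=(\phi_{\omega,\gamma},\dots,\phi_{\omega,\gamma})$ ($N$ equal components) with $$\phi_{\omega,\gamma}(x)=\sqrt{2\omega}\,\operatorname{sech}\left(\sqrt\omega\,x+\tanh^{-1}\left(\tfrac{\gamma}{N\sqrt\omega}\right)\right),\quad x>0.$$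
   Context: $\Gamma$ is the star graph made of $N\ge2$ half-lines $I_e=\mathbb{R}^+$, $e=1,\dots,N$, joined at the common vertex $0$. A function $u$ on $\Gamma$ is a vector $u=(u_e)_{e=1}^N$ of functions $u_e:\mathbb{R}^+\to\mathbb{C}$. $L^p(\Gamma)$ is the set of $u$ with $u_e\in L^p(\mathbb{R}^+)$ for all $e$, with $\|u\|_p^p=\sum_e\|u_e\|_{L^p(\mathbb{R}^+)}^p$ for $p<\infty$. $H^1(\Gamma)$ is the set of $u$ with $u_e\in H^1(\mathbb{R}^+)$ for all $e$ and $u_1(0)=\dots=u_N(0)$. Products, derivatives and moduli are taken componentwise. $X=H^1(\Gamma)\times H^1(\Gamma)$. Energy: $E(u,v)=\|u'\|_2^2+\|v'\|_2^2-\gamma(|u_1(0)|^2+|v_1(0)|^2)-\frac12(a\|u\|_4^4+c\|v\|_4^4)-b\|uv\|_2^2$. $J(\alpha,\beta)=\inf\{E(u,v): u,v\in H^1(\Gamma),\ \|u\|_2^2=\alpha,\ \|v\|_2^2=\beta\}$. Set of ground states: $\mathcal{G}(\alpha,\beta)=\{(u,v)\in X: E(u,v)=J(\alpha,\beta),\ \|u\|_2^2=\alpha,\ \|v\|_2^2=\beta\}$. *)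

theory Defs
  imports "HOL-Analysis.Analysis"
begin

text \<open>
  A function on the star graph is a family \<^term>\<open>u :: nat \<Rightarrow> real \<Rightarrow> complex\<close>; the component on the
  edge \<open>e \<in> {1..N}\<close> is \<open>u e\<close>, and the half-line is \<open>{0..}\<close> with \<open>0\<close> the vertex.
\<close>

abbreviation half_line :: "real measure" where
  "half_line \<equiv> lebesgue_on {0..}"

definition L2_half_line :: "(real \<Rightarrow> complex) set" where
  "L2_half_line = {f \<in> borel_measurable half_line. integrable half_line (\<lambda>x. (norm (f x))\<^sup>2)}"

definition test_function :: "(real \<Rightarrow> real) \<Rightarrow> bool" where
  "test_function \<phi> \<longleftrightarrow> \<phi> C1_differentiable_on UNIV \<and>
     (\<exists>K. compact K \<and> K \<subseteq> {0<..} \<and> (\<forall>x. x \<notin> K \<longrightarrow> \<phi> x = 0))"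

definition has_weak_derivative :: "(real \<Rightarrow> complex) \<Rightarrow> (real \<Rightarrow> complex) \<Rightarrow> bool" where
  "has_weak_derivative f g \<longleftrightarrow> (\<forall>\<phi>. test_function \<phi> \<longrightarrow>
     (LINT x|half_line. deriv \<phi> x *\<^sub>R f x) = - (LINT x|half_line. \<phi> x *\<^sub>R g x))"

text \<open>
  An element of \<open>H\<^sup>1\<close> of the half-line is represented by its unique continuous representative on
  \<open>{0..}\<close> (which gives the value at the vertex its meaning), made \<^const>\<open>extensional\<close> outside
  \<open>{0..}\<close>. Hence equality of elements of \<open>H\<^sup>1\<close> is equality in HOL.
\<close>

definition H1_half_line :: "(real \<Rightarrow> complex) set" where
  "H1_half_line = {f \<in> extensional {0..}. continuous_on {0..} f \<and> f \<in> L2_half_line \<and>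
     (\<exists>g \<in> L2_half_line. has_weak_derivative f g)}"

text \<open>Any choice will do: weak derivatives are unique up to null sets.\<close>

definition weak_deriv :: "(real \<Rightarrow> complex) \<Rightarrow> real \<Rightarrow> complex" where
  "weak_deriv f = (SOME g. g \<in> L2_half_line \<and> has_weak_derivative f g)"

definition H1_graph :: "nat \<Rightarrow> (nat \<Rightarrow> real \<Rightarrow> complex) set" where
  "H1_graph N = {u \<in> {1..N} \<rightarrow>\<^sub>E H1_half_line. \<forall>e\<in>{1..N}. u e 0 = u 1 0}"

definition Lp_norm :: "nat \<Rightarrow> nat \<Rightarrow> (nat \<Rightarrow> real \<Rightarrow> complex) \<Rightarrow> real" where
  "Lp_norm N p u = root p (\<Sum>e=1..N. LINT x|half_line. norm (u e x) ^ p)"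

definition energy :: "nat \<Rightarrow> real \<Rightarrow> real \<Rightarrow> real \<Rightarrow> real \<Rightarrow>
    (nat \<Rightarrow> real \<Rightarrow> complex) \<Rightarrow> (nat \<Rightarrow> real \<Rightarrow> complex) \<Rightarrow> real" where
  "energy N \<gamma> a b c u v =
     (Lp_norm N 2 (\<lambda>e. weak_deriv (u e)))\<^sup>2 + (Lp_norm N 2 (\<lambda>e. weak_deriv (v e)))\<^sup>2
     - \<gamma> * ((norm (u 1 0))\<^sup>2 + (norm (v 1 0))\<^sup>2)
     - 1/2 * (a * Lp_norm N 4 u ^ 4 + c * Lp_norm N 4 v ^ 4)
     - b * (Lp_norm N 2 (\<lambda>e x. u e x * v e x))\<^sup>2"

definition constraint_set :: "nat \<Rightarrow> real \<Rightarrow> real \<Rightarrow>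
    ((nat \<Rightarrow> real \<Rightarrow> complex) \<times> (nat \<Rightarrow> real \<Rightarrow> complex)) set" where
  "constraint_set N \<alpha> \<beta> = {(u, v). u \<in> H1_graph N \<and> v \<in> H1_graph N \<and>
     (Lp_norm N 2 u)\<^sup>2 = \<alpha> \<and> (Lp_norm N 2 v)\<^sup>2 = \<beta>}"

text \<open>
  The infimum is taken in the extended reals, since the infimum of a set of reals
  that is empty or not bounded below is not meaningful in HOL.
\<close>

definition ground_energy :: "nat \<Rightarrow> real \<Rightarrow> real \<Rightarrow> real \<Rightarrow> real \<Rightarrow> real \<Rightarrow> real \<Rightarrow> ereal" where
  "ground_energy N \<gamma> a b c \<alpha> \<beta> =
     (INF (u, v) \<in> constraint_set N \<alpha> \<beta>. ereal (energy N \<gamma> a b c u v))"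

definition ground_states :: "nat \<Rightarrow> real \<Rightarrow> real \<Rightarrow> real \<Rightarrow> real \<Rightarrow> real \<Rightarrow> real \<Rightarrow>
    ((nat \<Rightarrow> real \<Rightarrow> complex) \<times> (nat \<Rightarrow> real \<Rightarrow> complex)) set" where
  "ground_states N \<gamma> a b c \<alpha> \<beta> = {(u, v) \<in> constraint_set N \<alpha> \<beta>.
     ereal (energy N \<gamma> a b c u v) = ground_energy N \<gamma> a b c \<alpha> \<beta>}"

definition phi :: "nat \<Rightarrow> real \<Rightarrow> real \<Rightarrow> real \<Rightarrow> real" where
  "phi N \<omega> \<gamma> x = sqrt (2 * \<omega>) * (1 / cosh (sqrt \<omega> * x + artanh (\<gamma> / (real N * sqrt \<omega>))))"

definition Phi :: "nat \<Rightarrow> real \<Rightarrow> real \<Rightarrow> nat \<Rightarrow> real \<Rightarrow> complex" where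
  "Phi N \<omega> \<gamma> = (\<lambda>e\<in>{1..N}. \<lambda>x\<in>{0..}. complex_of_real (phi N \<omega> \<gamma> x))"

definition graph_scale :: "nat \<Rightarrow> complex \<Rightarrow> (nat \<Rightarrow> real \<Rightarrow> complex) \<Rightarrow> nat \<Rightarrow> real \<Rightarrow> complex" where
  "graph_scale N z u = (\<lambda>e\<in>{1..N}. \<lambda>x\<in>{0..}. z * u e x)"

end

theory Submission
  imports Defs
begin

text \<open>
  On an edge with components \<open>f\<close> and \<open>g = f'\<close>, put \<open>T(x) = y + (1 / 2r) \<integral>\<^sub>0\<^sup>x |f|\<^sup>2\<close>, where \<open>y\<close> is such
  that \<open>T\<close> tends to \<open>\<kappa>\<close> at infinity. Expanding \<open>|g + T f|\<^sup>2\<close> and integrating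
  \<open>T (|f|\<^sup>2)'\<close> by parts gives the nonlocal calibration identity
  \<open>\<integral>|g|\<^sup>2 - (1 / 2r) \<integral>|f|\<^sup>4 = \<integral>|g + T f|\<^sup>2 + y |f(0)|\<^sup>2 - (2r / 3) (\<kappa>\<^sup>3 - y\<^sup>3)\<close>.
  With \<open>\<kappa> = sqrt \<omega>\<close> on every edge the numbers \<open>y\<^sub>e\<close> add up to \<open>\<gamma>\<close>, so the vertex terms cancel, and the
  smallness of the mass makes \<open>\<Sum> y\<^sub>e\<^sup>3\<close> minimal exactly when all \<open>y\<^sub>e\<close> equal \<open>\<gamma> / N\<close>. Equality forces
  \<open>f' = - T f\<close>, hence \<open>T' = \<kappa>\<^sup>2 - T\<^sup>2\<close>, whose solution is the hyperbolic secant profile.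

  The system decouples. With \<open>p = (b - c) / (b\<^sup>2 - ac)\<close> and \<open>q = (b - a) / (b\<^sup>2 - ac)\<close> one has
  \<open>ap + bq = bp + cq = 1\<close>, and \<open>E(u, v)\<close> is the sum of two scalar energies with cubic coefficients \<open>1/p\<close> and
  \<open>1/q\<close> and of the nonnegative term \<open>b / (2pq) \<parallel>q |u|\<^sup>2 - p |v|\<^sup>2\<parallel>\<^sup>2\<close>.
\<close>

section \<open>Absolutely continuous functions on the half-line\<close>

text \<open>Local absolute continuity as one relation: \<open>f\<close> is a primitive of
  \<open>g\<close> on the half-line, which fixes \<open>g\<close> only up to null sets. It links
  weak derivatives, known almost everywhere, with classical ones.\<close>

definition ac_deriv :: "(real \<Rightarrow> 'a::euclidean_space) \<Rightarrow> (real \<Rightarrow> 'a) \<Rightarrow> bool" where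
  "ac_deriv f g \<longleftrightarrow> (\<forall>x\<ge>0. g absolutely_integrable_on {0..x} \<and> f x = f 0 + integral {0..x} g)"

lemma ac_deriv_absolutely_integrable:
  assumes "ac_deriv f g" "0 \<le> x"
  shows "g absolutely_integrable_on {x..y}"
proof (cases "x \<le> y")
  case True
  with assms have "g absolutely_integrable_on {0..y}"
    by (auto simp: ac_deriv_def)
  then show ?thesis
    by (rule absolutely_integrable_on_subinterval) (use assms(2) in auto)
qed (simp add: set_integrable_def)

lemma ac_deriv_eq: "ac_deriv f g \<Longrightarrow> 0 \<le> x \<Longrightarrow> f x = f 0 + integral {0..x} g"
  unfolding ac_deriv_def by blast

lemma ac_deriv_integrable:
  assumes "ac_deriv f g" "0 \<le> x"
  shows "g integrable_on {x..y}"
  using ac_deriv_absolutely_integrable[OF assms] by (simp add: absolutely_integrable_on_def)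

lemma ac_deriv_diff:
  assumes "ac_deriv f g" "0 \<le> x" "x \<le> y"
  shows "f y - f x = integral {x..y} g"
proof -
  have "integral {0..x} g + integral {x..y} g = integral {0..y} g"
    by (rule Henstock_Kurzweil_Integration.integral_combine)
      (use assms ac_deriv_integrable[of f g 0 y] in auto)
  moreover have "f x = f 0 + integral {0..x} g" "f y = f 0 + integral {0..y} g"
    using assms by (auto intro!: ac_deriv_eq)
  ultimately show ?thesis by (simp add: algebra_simps)
qed

lemma ac_deriv_continuous_on:
  assumes "ac_deriv f g"
  shows "continuous_on {0..} f"
proof -
  have "continuous_on {0..R} f" for R
  proof -
    have "continuous_on {0..R} (\<lambda>x. f 0 + integral {0..x} g)"
      using ac_deriv_integrable[OF assms, of 0 R]
      by (intro continuous_intros indefinite_integral_continuous_1) auto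
    then show ?thesis
      by (rule continuous_on_eq) (auto intro!: ac_deriv_eq[OF assms, symmetric])
  qed
  then have c: "continuous_on {0..<R} f" for R
    by (rule continuous_on_subset[of "{0..R}"]) auto
  show ?thesis
    unfolding continuous_on_eq_continuous_within
  proof
    fix x :: real assume x: "x \<in> {0..}"
    have "at x within {0..} = at x within {0..<x+1}"
      by (rule at_within_nhd[of _ "{..<x+1}"]) (use x in auto)
    then show "continuous (at x within {0..}) f"
      using c[of "x+1"] x by (auto simp: continuous_on_eq_continuous_within continuous_within)
  qed
qed

lemma ac_deriv_linear:
  assumes "ac_deriv f g" and h: "bounded_linear h"
  shows "ac_deriv (\<lambda>x. h (f x)) (\<lambda>x. h (g x))"
  unfolding ac_deriv_def
proof (intro allI impI conjI)
  fix x :: real assume x: "0 \<le> x"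
  show "(\<lambda>x. h (g x)) absolutely_integrable_on {0..x}"
    using absolutely_integrable_linear[OF ac_deriv_absolutely_integrable[OF assms(1)] h] x
    by (auto simp: o_def)
  have "integral {0..x} (\<lambda>x. h (g x)) = h (integral {0..x} g)"
    using integral_linear[OF ac_deriv_integrable[OF assms(1)] h, of 0 x] by (simp add: o_def)
  moreover have "f x = f 0 + integral {0..x} g"
    by (rule ac_deriv_eq[OF assms(1) x])
  ultimately show "h (f x) = h (f 0) + integral {0..x} (\<lambda>x. h (g x))"
    using h by (simp add: linear_simps)
qed

lemma ac_deriv_of_vector_derivative:
  assumes "\<And>x. 0 \<le> x \<Longrightarrow> (f has_vector_derivative f' x) (at x within {0..})"
    and "continuous_on {0..} f'"
  shows "ac_deriv f f'"
  unfolding ac_deriv_def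
proof (intro allI impI conjI)
  fix x :: real assume x: "0 \<le> x"
  show "f' absolutely_integrable_on {0..x}"
    by (rule absolutely_integrable_continuous_real)
      (rule continuous_on_subset[OF assms(2)], auto)
  have "(f' has_integral f x - f 0) {0..x}"
    by (rule fundamental_theorem_of_calculus[OF x])
      (rule has_vector_derivative_within_subset[OF assms(1)], auto)
  then show "f x = f 0 + integral {0..x} f'"
    by (simp add: integral_unique)
qed

text \<open>For a continuous integrand the almost everywhere derivative is classical, one-sided at
  0. This is what turns \<open>f' = - T f\<close> into an ordinary differential equation.\<close>

lemma ac_deriv_has_vector_derivative:
  assumes "ac_deriv f g" "continuous_on {0..} g" "0 \<le> x"
  shows "(f has_vector_derivative g x) (at x within {0..})"
proof -
  have c: "continuous_on {0..x+1} g"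
    by (rule continuous_on_subset[OF assms(2)]) auto
  have "((\<lambda>u. integral {0..u} g) has_vector_derivative g x) (at x within {0..x+1})"
    by (rule integral_has_vector_derivative[OF c]) (use assms in auto)
  then have "((\<lambda>u. f 0 + integral {0..u} g) has_vector_derivative g x) (at x within {0..x+1})"
    by (auto intro!: derivative_eq_intros)
  then have "(f has_vector_derivative g x) (at x within {0..x+1})"
    by (rule has_vector_derivative_transform[rotated 2])
      (use assms in \<open>auto intro!: ac_deriv_eq\<close>)
  moreover have "at x within {0..x+1} = at x within {0..}"
    by (rule at_within_nhd[of _ "{..<x+1}"]) (use assms in auto)
  ultimately show ?thesis by simp
qed

lemma ac_deriv_has_real_derivative:
  assumes "ac_deriv f g" "continuous_on {0..} g" "0 \<le> x"
  shows "(f has_real_derivative g x) (at x within {0..})"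
  using ac_deriv_has_vector_derivative[OF assms]
  by (simp add: has_real_derivative_iff_has_vector_derivative)

section \<open>The product rule for locally absolutely continuous functions\<close>

lemma absolutely_integrable_mult_continuous:
  fixes f g :: "real \<Rightarrow> 'a::{euclidean_space, real_normed_field}"
  assumes "continuous_on {x..y} f" "g absolutely_integrable_on {x..y}"
  shows "(\<lambda>t. f t * g t) absolutely_integrable_on {x..y}"
proof (rule absolutely_integrable_bounded_measurable_product[OF bilinear_times _ _ _ assms(2)])
  show "f \<in> borel_measurable (lebesgue_on {x..y})"
    by (rule continuous_imp_measurable_on_sets_lebesgue[OF assms(1)]) auto
  show "bounded (f ` {x..y})"
    using assms(1) compact_continuous_image compact_imp_bounded by blast
qed auto

text \<open>On a short interval the increment of \<open>f h\<close> differs from the integral of \<open>f' h + f h'\<close> by at most the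
  oscillation of \<open>f\<close> and \<open>h\<close> times the integral of \<open>|f'| + |h'|\<close>; this is summed over fine partitions.\<close>

lemma ac_deriv_mult:
  fixes f h :: "real \<Rightarrow> 'a::{euclidean_space, real_normed_field}"
  assumes f: "ac_deriv f f'" and h: "ac_deriv h h'"
  shows "ac_deriv (\<lambda>x. f x * h x) (\<lambda>x. f' x * h x + f x * h' x)"
proof -
  define G where "G = (\<lambda>x. f' x * h x + f x * h' x)"
  have cf: "continuous_on {x..y} f" and ch: "continuous_on {x..y} h" if "0 \<le> x" for x y
    using continuous_on_subset[OF ac_deriv_continuous_on[OF f], of "{x..y}"]
      continuous_on_subset[OF ac_deriv_continuous_on[OF h], of "{x..y}"] that by auto
  have ai1: "(\<lambda>t. f' t * h t) absolutely_integrable_on {x..y}"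
    and ai2: "(\<lambda>t. f t * h' t) absolutely_integrable_on {x..y}" if "0 \<le> x" for x y
    using absolutely_integrable_mult_continuous[OF ch ac_deriv_absolutely_integrable[OF f]]
      absolutely_integrable_mult_continuous[OF cf ac_deriv_absolutely_integrable[OF h]] that
    by (auto simp: mult.commute)
  have aiG: "G absolutely_integrable_on {x..y}" if "0 \<le> x" for x y
    unfolding G_def using ai1[OF that] ai2[OF that] by (rule set_integral_add)
  define K where "K = (\<lambda>t. norm (f' t) + norm (h' t))"
  have iK: "K integrable_on {x..y}" if "0 \<le> x" for x y
    unfolding K_def using ac_deriv_absolutely_integrable[OF f that, of y]
      ac_deriv_absolutely_integrable[OF h that, of y]
    by (intro integrable_add) (auto simp: absolutely_integrable_on_def)
  have step: "norm (f y * h y - f x * h x - integral {x..y} G) \<le> e * integral {x..y} K"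
    if "0 \<le> x" "x \<le> y" and osc: "\<And>s t. s \<in> {x..y} \<Longrightarrow> t \<in> {x..y} \<Longrightarrow> norm (f s - f t) \<le> e \<and> norm (h s - h t) \<le> e"
    for x y e
  proof -
    have i1: "(f' has_integral (f y - f x)) {x..y}" and i2: "(h' has_integral (h y - h x)) {x..y}"
      using ac_deriv_integrable[OF f that(1)] ac_deriv_integrable[OF h that(1)]
        ac_deriv_diff[OF f that(1,2)] ac_deriv_diff[OF h that(1,2)]
      by (auto simp: has_integral_iff)
    have iG: "(G has_integral integral {x..y} G) {x..y}"
      using aiG[OF that(1)] by (auto simp: absolutely_integrable_on_def)
    \<comment> \<open>Discrete product rule: the increment of the product is
      \<open>(f y - f x) * h x + f y * (h y - h x)\<close>, hence the integral of
      \<open>f' t * h x + f y * h' t\<close>, where one factor of each summand is frozen at an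
      endpoint.\<close>
    have "((\<lambda>t. f' t * h x + f y * h' t - G t) has_integral
       ((f y - f x) * h x + f y * (h y - h x) - integral {x..y} G)) {x..y}"
      by (intro has_integral_diff has_integral_add has_integral_mult_left has_integral_mult_right i1 i2 iG)
    also have "(f y - f x) * h x + f y * (h y - h x) - integral {x..y} G = f y * h y - f x * h x - integral {x..y} G"
      by (simp add: algebra_simps)
    finally have hi: "((\<lambda>t. f' t * h x + f y * h' t - G t) has_integral
       (f y * h y - f x * h x - integral {x..y} G)) {x..y}" .
    have "norm (integral {x..y} (\<lambda>t. f' t * h x + f y * h' t - G t)) \<le> integral {x..y} (\<lambda>t. e * K t)"
    proof (rule integral_norm_bound_integral)
      show "(\<lambda>t. f' t * h x + f y * h' t - G t) integrable_on {x..y}"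
        using hi by (auto simp: has_integral_iff)
      show "(\<lambda>t. e * K t) integrable_on {x..y}"
        using iK[OF that(1)] by (rule integrable_on_mult_right)
      fix t assume t: "t \<in> {x..y}"
      have "norm (f' t * h x + f y * h' t - G t) = norm (f' t * (h x - h t) + (f y - f t) * h' t)"
        by (simp add: G_def algebra_simps)
      also have "\<dots> \<le> norm (f' t) * norm (h x - h t) + norm (f y - f t) * norm (h' t)"
        by (rule order_trans[OF norm_triangle_ineq]) (simp add: norm_mult)
      also have "\<dots> \<le> norm (f' t) * e + e * norm (h' t)"
        using osc[of x t] osc[of y t] t that
        by (intro add_mono mult_left_mono mult_right_mono) auto
      finally show "norm (f' t * h x + f y * h' t - G t) \<le> e * K t"
        by (simp add: K_def algebra_simps)
    qed
    then show ?thesis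
      using hi by (simp add: has_integral_iff)
  qed
  have main: "f x * h x - f 0 * h 0 = integral {0..x} G" if x: "0 \<le> x" for x
  proof -
    have bound: "norm (f x * h x - f 0 * h 0 - integral {0..x} G) \<le> e * integral {0..x} K" if e: "e > 0" for e
    proof -
      have "uniformly_continuous_on {0..x} f" "uniformly_continuous_on {0..x} h"
        using cf[of 0 x] ch[of 0 x] by (auto intro: compact_uniformly_continuous)
      then obtain d1 d2 where d1: "d1 > 0" "\<And>s t. s \<in> {0..x} \<Longrightarrow> t \<in> {0..x} \<Longrightarrow> dist s t < d1 \<Longrightarrow> dist (f s) (f t) < e"
        and d2: "d2 > 0" "\<And>s t. s \<in> {0..x} \<Longrightarrow> t \<in> {0..x} \<Longrightarrow> dist s t < d2 \<Longrightarrow> dist (h s) (h t) < e"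
        unfolding uniformly_continuous_on_def using e by metis
      \<comment> \<open>\<open>n\<close> is taken so large that the mesh \<open>x / n\<close> is
        below both moduli of continuity.\<close>
      obtain n :: nat where n: "x / min d1 d2 < real n"
        using reals_Archimedean2 by blast
      have dpos: "min d1 d2 > 0" using d1(1) d2(1) by simp
      have n0: "n > 0"
        using le_less_trans[OF divide_nonneg_pos[OF x dpos] n] by simp
      define \<delta> where "\<delta> = x / n"
      have \<delta>: "0 \<le> \<delta>" "\<delta> < min d1 d2"
        using n n0 x dpos
        by (simp_all only: \<delta>_def pos_divide_less_eq of_nat_0_less_iff divide_nonneg_pos mult.commute)
      \<comment> \<open>Summation over the partition points \<open>k * \<delta>\<close>: the
        increments and both integrals are additive, so the local errors add up to at most
        \<open>e\<close> times the integral of \<open>K\<close>.\<close>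
      have "norm (f (k * \<delta>) * h (k * \<delta>) - f 0 * h 0 - integral {0..k*\<delta>} G) \<le> e * integral {0..k*\<delta>} K" if "k \<le> n" for k :: nat
        using that
      proof (induction k)
        case (Suc k)
        define a where "a = k * \<delta>"
        define b where "b = Suc k * \<delta>"
        have ab: "0 \<le> a" "a \<le> b" "b - a = \<delta>"
          using \<delta> by (auto simp: a_def b_def algebra_simps)
        have "b \<le> n * \<delta>" using Suc.prems \<delta> unfolding b_def by (intro mult_right_mono) auto
        then have bx: "b \<le> x" using n0 by (simp add: \<delta>_def)
        have s: "norm (f b * h b - f a * h a - integral {a..b} G) \<le> e * integral {a..b} K"
        proof (rule step[OF ab(1,2)])
          fix s t assume st: "s \<in> {a..b}" "t \<in> {a..b}"
          then have "\<bar>s - t\<bar> \<le> \<delta>" using ab(3) by auto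
          then have "dist s t < d1" "dist s t < d2" "s \<in> {0..x}" "t \<in> {0..x}"
            using st ab(1) \<delta>(2) bx by (auto simp: dist_real_def)
          then show "norm (f s - f t) \<le> e \<and> norm (h s - h t) \<le> e"
            using d1(2)[of s t] d2(2)[of s t] by (simp add: dist_norm)
        qed
        have cG: "integral {0..a} G + integral {a..b} G = integral {0..b} G"
          by (rule Henstock_Kurzweil_Integration.integral_combine)
            (use ab aiG[of 0 b] in \<open>auto simp: absolutely_integrable_on_def\<close>)
        have cK: "integral {0..a} K + integral {a..b} K = integral {0..b} K"
          by (rule Henstock_Kurzweil_Integration.integral_combine) (use ab iK[of 0 b] in auto)
        have IH: "norm (f a * h a - f 0 * h 0 - integral {0..a} G) \<le> e * integral {0..a} K"
          using Suc by (auto simp: a_def)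
        have "norm (f b * h b - f 0 * h 0 - integral {0..b} G) \<le> e * integral {0..b} K"
          unfolding cG[symmetric] cK[symmetric] distrib_left
          using norm_triangle_le[OF add_mono[OF IH s]] by (simp add: algebra_simps)
        then show ?case by (simp only: b_def)
      qed simp
      from this[of n] show ?thesis using n0 by (simp add: \<delta>_def)
    qed
    have "norm (f x * h x - f 0 * h 0 - integral {0..x} G) \<le> 0"
    proof (rule field_le_epsilon)
      fix e :: real assume e: "e > 0"
      have K0: "integral {0..x} K \<ge> 0"
        by (rule integral_nonneg[OF iK]) (auto simp: K_def)
      \<comment> \<open>The summand 1 keeps the denominator positive when the integral of
        \<open>K\<close> is zero.\<close>
      have "norm (f x * h x - f 0 * h 0 - integral {0..x} G) \<le> e / (integral {0..x} K + 1) * integral {0..x} K"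
        using bound[of "e / (integral {0..x} K + 1)"] e K0 by simp
      also have "\<dots> \<le> e" using e K0 by (simp add: field_simps)
      finally show "norm (f x * h x - f 0 * h 0 - integral {0..x} G) \<le> 0 + e" by simp
    qed
    then show ?thesis by simp
  qed
  show ?thesis
    unfolding ac_deriv_def G_def[symmetric]
  proof (intro allI impI conjI)
    fix x :: real assume x: "0 \<le> x"
    show "G absolutely_integrable_on {0..x}" by (rule aiG) simp
    show "f x * h x = f 0 * h 0 + integral {0..x} G"
      using main[OF x] by (simp add: algebra_simps)
  qed
qed

text \<open>Dominated convergence along an arbitrary sequence tending to infinity: the truncations
  of \<open>G\<close> are bounded by \<open>norm (G t)\<close>. It supplies the boundary terms at
  infinity when integrating by parts.\<close>

lemma ac_deriv_tendsto:
  assumes "ac_deriv F G" "G absolutely_integrable_on {0..}"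
  shows "(F \<longlongrightarrow> F 0 + integral {0..} G) at_top"
proof (rule tendsto_at_topI_sequentially)
  fix X :: "nat \<Rightarrow> real" assume X: "filterlim X at_top sequentially"
  have "(\<lambda>n. integral {0..} (\<lambda>t. if t \<in> {0..X n} then G t else 0)) \<longlonglongrightarrow> integral {0..} G"
  proof (rule dominated_convergence(2))
    show "(\<lambda>t. norm (G t)) integrable_on {0..}"
      using assms(2) by (auto simp: absolutely_integrable_on_def)
    show "(\<lambda>t. if t \<in> {0..X n} then G t else 0) integrable_on {0..}" for n
    proof -
      have "G integrable_on {0..X n} \<inter> {0..}"
        using ac_deriv_integrable[OF assms(1), of 0 "X n"] by (simp add: Int_absorb2 subset_iff)
      then show ?thesis by (subst integrable_restrict_Int)
    qed
    show "(\<lambda>n. if t \<in> {0..X n} then G t else 0) \<longlonglongrightarrow> G t" if "t \<in> {0..}" for t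
    proof (rule tendsto_eventually)
      show "\<forall>\<^sub>F n in sequentially. (if t \<in> {0..X n} then G t else 0) = G t"
        using X[unfolded filterlim_at_top, rule_format, of t] by eventually_elim (use that in auto)
    qed
  qed auto
  then have "(\<lambda>n. F 0 + integral {0..} (\<lambda>t. if t \<in> {0..X n} then G t else 0)) \<longlonglongrightarrow> F 0 + integral {0..} G"
    by (intro tendsto_intros)
  moreover have "\<forall>\<^sub>F n in sequentially. F 0 + integral {0..} (\<lambda>t. if t \<in> {0..X n} then G t else 0) = F (X n)"
    using X[unfolded filterlim_at_top, rule_format, of 0]
  proof eventually_elim
    case (elim n)
    have "F (X n) = F 0 + integral {0..X n} G"
      by (rule ac_deriv_eq[OF assms(1) elim])
    moreover
    have "integral {0..} (\<lambda>t. if t \<in> {0..X n} then G t else 0) = integral ({0..X n} \<inter> {0..}) G"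
      by (rule Henstock_Kurzweil_Integration.integral_restrict_Int)
    moreover have "{0..X n} \<inter> {0..} = {0..X n}" by auto
    ultimately show ?case by simp
  qed
  ultimately show "(\<lambda>n. F (X n)) \<longlonglongrightarrow> F 0 + integral {0..} G"
    by (rule Lim_transform_eventually)
qed

text \<open>A positive limit would keep \<open>F\<close> above \<open>L / 2\<close> on a whole tail,
  and a long enough interval there would carry more than the total integral.\<close>

lemma integrable_nonneg_limit_zero:
  fixes F :: "real \<Rightarrow> real"
  assumes F: "F integrable_on {0..}" "\<And>x. 0 \<le> x \<Longrightarrow> 0 \<le> F x" and lim: "(F \<longlongrightarrow> L) at_top"
  shows "L = 0"
proof (rule ccontr)
  assume "L \<noteq> 0"
  moreover have "L \<ge> 0"
    using lim by (rule tendsto_lowerbound) (auto intro!: eventually_mono[OF eventually_ge_at_top[of 0]] F)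
  ultimately have "L > 0" by simp
  then have "\<forall>\<^sub>F x in at_top. F x > L / 2"
    using lim by (intro order_tendstoD) auto
  then obtain R0 where R0: "\<And>x. x \<ge> R0 \<Longrightarrow> F x > L / 2"
    by (auto simp: eventually_at_top_linorder)
  define R where "R = max R0 0"
  \<comment> \<open>A length, chosen so that \<open>n * L / 2\<close> is the total integral plus
    1.\<close>
  define n where "n = 2 * (integral {0..} F + 1) / L"
  have I0: "integral {0..} F \<ge> 0" by (rule integral_nonneg) (use F in auto)
  have n: "n \<ge> 0" using I0 \<open>L > 0\<close> by (simp add: n_def)
  have i: "F integrable_on {R..R+n}"
    by (rule integrable_on_subinterval[OF F(1)]) (auto simp: R_def)
  have "integral {R..R+n} (\<lambda>_. L / 2) \<le> integral {R..R+n} F"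
    by (rule integral_le) (use i R0 in \<open>auto simp: R_def intro: less_imp_le\<close>)
  also have "\<dots> \<le> integral {0..} F"
    by (rule integral_subset_le) (use i F in \<open>auto simp: R_def\<close>)
  finally show False using n \<open>L > 0\<close> by (simp add: n_def field_simps)
qed

section \<open>Weak derivatives\<close>

text \<open>Bridge between the Bochner integrals of the definitions and the gauge integrals in which
  the calculus is done.\<close>

lemma half_line_integral:
  fixes f :: "real \<Rightarrow> 'a::euclidean_space"
  assumes "f absolutely_integrable_on {0..}"
  shows "integrable half_line f" "(LINT x|half_line. f x) = integral {0..} f"
proof -
  show "integrable half_line f"
    using assms by (rule absolutely_integrable_imp_integrable) auto
  then show "(LINT x|half_line. f x) = integral {0..} f"
    by (rule lebesgue_integral_eq_integral) auto
qed

lemma absolutely_integrable_half_line: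
  fixes f :: "real \<Rightarrow> 'a::euclidean_space"
  assumes "integrable half_line f"
  shows "f absolutely_integrable_on {0..}"
  using assms by (simp add: set_integrable_def integrable_restrict_space)

lemma absolutely_integrable_on_superset:
  fixes f :: "'n::euclidean_space \<Rightarrow> 'a::euclidean_space"
  assumes "f absolutely_integrable_on S" "S \<subseteq> T" "\<And>x. x \<in> T - S \<Longrightarrow> f x = 0"
  shows "f absolutely_integrable_on T"
proof -
  have "(\<lambda>x. if x \<in> T then f x else 0) = (\<lambda>x. if x \<in> S then f x else 0)"
    using assms(2,3) by (auto simp: fun_eq_iff)
  then show ?thesis
    using assms(1) by (metis absolutely_integrable_restrict_UNIV)
qed

lemma L2_half_lineD:
  assumes "f \<in> L2_half_line"
  shows "f \<in> borel_measurable half_line" "(\<lambda>x. (norm (f x))\<^sup>2) absolutely_integrable_on {0..}"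
  using assms by (auto simp: L2_half_line_def intro: absolutely_integrable_half_line)

text \<open>Constants are integrable on a bounded interval, and a norm is at most 1 plus its
  square.\<close>

lemma L2_half_line_absolutely_integrable_Icc:
  assumes "f \<in> L2_half_line" "0 \<le> x"
  shows "f absolutely_integrable_on {x..y}"
proof (rule measurable_bounded_by_integrable_imp_absolutely_integrable)
  show "f \<in> borel_measurable (lebesgue_on {x..y})"
    by (rule measurable_restrict_mono[OF L2_half_lineD(1)[OF assms(1)]]) (use assms in auto)
  have "(\<lambda>t. (norm (f t))\<^sup>2) integrable_on {x..y}"
    by (rule integrable_on_subinterval[of _ "{0..}"])
      (use L2_half_lineD(2)[OF assms(1)] assms(2) in \<open>auto simp: absolutely_integrable_on_def\<close>)
  then show "(\<lambda>t. 1 + (norm (f t))\<^sup>2) integrable_on {x..y}"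
    by (intro integrable_add) auto
  fix t
  show "norm (f t) \<le> 1 + (norm (f t))\<^sup>2"
    using sum_squares_bound[of 1 "norm (f t)"] norm_ge_zero[of "f t"]
    unfolding power_one mult_1_right by linarith
qed auto

text \<open>\<open>bump h\<close> is the tent of mass \<open>1\<close> on \<open>[0, 2h]\<close> and \<open>step h\<close> its primitive, so that
  \<open>step h (t - x) - step h (t - y)\<close> is an admissible test function close to the indicator of \<open>[x, y]\<close>.\<close>

definition bump :: "real \<Rightarrow> real \<Rightarrow> real" where
  "bump h t = (max 0 t - 2 * max 0 (t - h) + max 0 (t - 2 * h)) / h\<^sup>2"

definition step :: "real \<Rightarrow> real \<Rightarrow> real" where
  "step h t = ((max 0 t)\<^sup>2 - 2 * (max 0 (t - h))\<^sup>2 + (max 0 (t - 2 * h))\<^sup>2) / (2 * h\<^sup>2)"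

section \<open>Elementary properties of the tent function and its primitive\<close>

lemma has_real_derivative_pos_part_squared:
  "((\<lambda>t::real. (max 0 t)\<^sup>2) has_real_derivative 2 * max 0 t) (at t)"
proof -
  consider "t < 0" | "t > 0" | "t = 0" by linarith
  then show ?thesis
  proof cases
    case 1
    have "((\<lambda>_. 0) has_real_derivative 0) (at t)" by simp
    then have "((\<lambda>t::real. (max 0 t)\<^sup>2) has_real_derivative 0) (at t)"
      by (rule has_field_derivative_transform_within_open[of _ _ _ "{..<0}"]) (use 1 in auto)
    then show ?thesis using 1 by (simp add: max_def)
  next
    case 2
    have "((\<lambda>t. t\<^sup>2) has_real_derivative 2 * t) (at t)"
      by (auto intro!: derivative_eq_intros)
    then have "((\<lambda>t::real. (max 0 t)\<^sup>2) has_real_derivative 2 * t) (at t)"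
      by (rule has_field_derivative_transform_within_open[of _ _ _ "{0<..}"]) (use 2 in auto)
    then show ?thesis using 2 by (simp add: max_def)
  next
    case 3
    \<comment> \<open>At the kink the difference quotient is at most |k| in modulus.\<close>
    have "((\<lambda>k. ((max 0 (0 + k))\<^sup>2 - (max 0 0)\<^sup>2) / k) \<longlongrightarrow> 0) (at (0::real))"
    proof (rule Lim_null_comparison)
      show "\<forall>\<^sub>F k in at (0::real). norm (((max 0 (0 + k))\<^sup>2 - (max 0 0)\<^sup>2) / k) \<le> \<bar>k\<bar>"
        by (intro always_eventually) (auto simp: max_def power2_eq_square)
      show "((\<lambda>k. \<bar>k\<bar>) \<longlongrightarrow> 0) (at (0::real))"
        by (intro tendsto_rabs_zero tendsto_ident_at)
    qed
    then show ?thesis using 3 by (simp add: DERIV_def)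
  qed
qed

lemma has_real_derivative_step:
  assumes "h > 0"
  shows "((\<lambda>t. step h (t - x)) has_real_derivative bump h (t - x)) (at t within A)"
proof -
  have shift: "((\<lambda>t. (max 0 (t - c))\<^sup>2) has_real_derivative 2 * max 0 (t - c)) (at t)" for c
  proof -
    have "((\<lambda>t. t - c) has_real_derivative 1) (at t)"
      by (auto intro!: derivative_eq_intros)
    from DERIV_chain2[where f = "\<lambda>t. (max 0 t)\<^sup>2" and g = "\<lambda>t. t - c" and x = t,
        OF has_real_derivative_pos_part_squared this]
    show ?thesis by simp
  qed
  have "((\<lambda>t. ((max 0 (t - x))\<^sup>2 - 2 * (max 0 (t - (x + h)))\<^sup>2 + (max 0 (t - (x + 2 * h)))\<^sup>2) / (2 * h\<^sup>2))
     has_real_derivative (2 * max 0 (t - x) - 2 * (2 * max 0 (t - (x + h))) + 2 * max 0 (t - (x + 2 * h))) / (2 * h\<^sup>2)) (at t)"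
    by (intro DERIV_cdivide DERIV_add DERIV_diff DERIV_cmult shift)
  moreover have half: "(2 * A - 2 * (2 * B) + 2 * C) / (2 * h\<^sup>2) = (A - 2 * B + C) / h\<^sup>2" for A B C :: real
    using assms by (simp add: field_simps)
  ultimately have "((\<lambda>t. step h (t - x)) has_real_derivative bump h (t - x)) (at t)"
    unfolding step_def bump_def diff_diff_eq by (simp only: half)
  then show ?thesis by (rule has_field_derivative_at_within)
qed

lemma step_left: "h > 0 \<Longrightarrow> t \<le> 0 \<Longrightarrow> step h t = 0"
  by (auto simp: step_def max_def)

lemma step_right: "h > 0 \<Longrightarrow> t \<ge> 2 * h \<Longrightarrow> step h t = 1"
  by (auto simp: step_def max_def power2_eq_square field_simps)

lemma bump_nonneg: "h > 0 \<Longrightarrow> bump h t \<ge> 0"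
  by (auto simp: bump_def max_def)

lemma bump_eq_0: "h > 0 \<Longrightarrow> t \<le> 0 \<or> t \<ge> 2 * h \<Longrightarrow> bump h t = 0"
  by (auto simp: bump_def max_def)

lemma continuous_on_bump: "continuous_on A (\<lambda>t. bump h (t - x))"
  unfolding bump_def divide_inverse by (intro continuous_intros)

lemma step_mono: "h > 0 \<Longrightarrow> s \<le> t \<Longrightarrow> step h s \<le> step h t"
  using DERIV_nonneg_imp_nondecreasing[of s t "step h"]
    has_real_derivative_step[of h 0 _ UNIV] bump_nonneg[of h] by force

lemma step_bounds: "h > 0 \<Longrightarrow> 0 \<le> step h t \<and> step h t \<le> 1"
  using step_mono[of h "min t 0" t] step_mono[of h t "max t (2 * h)"]
    step_left[of h "min t 0"] step_right[of h "max t (2 * h)"] by auto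

lemma bump_has_integral:
  assumes "h > 0"
  shows "((\<lambda>t. bump h (t - x)) has_integral 1) {x..x + 2 * h}"
proof -
  have "((\<lambda>t. bump h (t - x)) has_integral (step h (x + 2 * h - x) - step h (x - x))) {x..x + 2 * h}"
    by (rule fundamental_theorem_of_calculus)
      (use assms in \<open>auto simp flip: has_real_derivative_iff_has_vector_derivative intro!: has_real_derivative_step\<close>)
  then show ?thesis using assms by (simp add: step_left step_right)
qed

text \<open>The shifted tent is a probability density on \<open>{x..x + 2 * h}\<close>, so the
  weighted mean of \<open>f\<close> differs from \<open>f x\<close> by at most the oscillation of
  \<open>f\<close> there. The support lies to the right of \<open>x\<close>, hence inside the
  half-line even for \<open>x = 0\<close>.\<close>

lemma bump_average:
  fixes f :: "real \<Rightarrow> complex"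
  assumes h: "h > 0" and x: "x \<ge> 0" and f: "continuous_on {0..} f"
  shows "(\<lambda>t. bump h (t - x) *\<^sub>R f t) absolutely_integrable_on {0..}"
    and "(\<And>t. t \<in> {x..x + 2 * h} \<Longrightarrow> norm (f t - f x) \<le> e) \<Longrightarrow>
      norm ((LINT t|half_line. bump h (t - x) *\<^sub>R f t) - f x) \<le> e"
proof -
  define F where "F = (\<lambda>t. bump h (t - x) *\<^sub>R f t)"
  have cf: "continuous_on {x..x + 2 * h} f"
    by (rule continuous_on_subset[OF f]) (use x in auto)
  have F1: "F absolutely_integrable_on {x..x + 2 * h}"
    unfolding F_def
    by (intro absolutely_integrable_continuous_real continuous_intros continuous_on_bump cf)
  have F0: "F t = 0" if "t \<notin> {x..x + 2 * h}" for t
    using bump_eq_0[OF h, of "t - x"] that by (auto simp: F_def)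
  have F2: "F absolutely_integrable_on {0..}"
    by (rule absolutely_integrable_on_superset[OF F1]) (use x F0 in auto)
  then show "(\<lambda>t. bump h (t - x) *\<^sub>R f t) absolutely_integrable_on {0..}"
    by (simp add: F_def)
  assume e: "\<And>t. t \<in> {x..x + 2 * h} \<Longrightarrow> norm (f t - f x) \<le> e"
  have I: "(LINT t|half_line. F t) = integral {x..x + 2 * h} F"
    unfolding half_line_integral(2)[OF F2]
    by (rule integral_unique[OF has_integral_on_superset[of _ _ "{x..x + 2 * h}"]])
      (use F1 F0 x in \<open>auto simp: absolutely_integrable_on_def\<close>)
  have "((\<lambda>t. F t - bump h (t - x) *\<^sub>R f x) has_integral integral {x..x + 2 * h} F - 1 *\<^sub>R f x) {x..x + 2 * h}"
    by (intro has_integral_diff has_integral_scaleR_left bump_has_integral h)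
      (use F1 in \<open>auto simp: absolutely_integrable_on_def\<close>)
  then have hi: "((\<lambda>t. F t - bump h (t - x) *\<^sub>R f x) has_integral (LINT t|half_line. F t) - f x) {x..x + 2 * h}"
    by (simp add: I)
  have be: "((\<lambda>t. bump h (t - x) * e) has_integral 1 * e) {x..x + 2 * h}"
    by (intro has_integral_mult_left bump_has_integral h)
  have "norm (integral {x..x + 2 * h} (\<lambda>t. F t - bump h (t - x) *\<^sub>R f x)) \<le> integral {x..x + 2 * h} (\<lambda>t. bump h (t - x) * e)"
  proof (rule integral_norm_bound_integral)
    fix t assume t: "t \<in> {x..x + 2 * h}"
    have "norm (F t - bump h (t - x) *\<^sub>R f x) = bump h (t - x) * norm (f t - f x)"
      using bump_nonneg[OF h] by (simp add: F_def flip: scaleR_diff_right)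
    also have "\<dots> \<le> bump h (t - x) * e"
      by (intro mult_left_mono e t bump_nonneg h)
    finally show "norm (F t - bump h (t - x) *\<^sub>R f x) \<le> bump h (t - x) * e" .
  qed (use hi be in \<open>auto simp: has_integral_iff\<close>)
  then show "norm ((LINT t|half_line. bump h (t - x) *\<^sub>R f t) - f x) \<le> e"
    unfolding integral_unique[OF hi] integral_unique[OF be] by (simp add: F_def)
qed

lemma bump_average_tendsto:
  fixes f :: "real \<Rightarrow> complex"
  assumes x: "x \<ge> 0" and f: "continuous_on {0..} f"
  shows "(\<lambda>n. LINT t|half_line. bump (1 / real (Suc n)) (t - x) *\<^sub>R f t) \<longlonglongrightarrow> f x"
proof (rule LIMSEQ_I)
  fix e :: real assume e: "e > 0"
  obtain d where d: "d > 0" "\<And>t. t \<in> {0..} \<Longrightarrow> dist t x < d \<Longrightarrow> dist (f t) (f x) < e / 2"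
    using f x e unfolding continuous_on_iff by (metis atLeast_iff half_gt_zero)
  obtain n0 :: nat where n0: "2 / d < real n0" using reals_Archimedean2 by blast
  show "\<exists>no. \<forall>n\<ge>no. norm ((LINT t|half_line. bump (1 / real (Suc n)) (t - x) *\<^sub>R f t) - f x) < e"
  proof (intro exI allI impI)
    fix n assume "n0 \<le> n"
    then have "2 / d < real (Suc n)" using n0 by linarith
    then have "2 * (1 / real (Suc n)) < d" using d(1) by (simp add: field_simps)
    then have "norm ((LINT t|half_line. bump (1 / real (Suc n)) (t - x) *\<^sub>R f t) - f x) \<le> e / 2"
      using d(2) x by (intro bump_average(2) f) (auto simp: dist_norm intro!: less_imp_le)
    then show "norm ((LINT t|half_line. bump (1 / real (Suc n)) (t - x) *\<^sub>R f t) - f x) < e"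
      using e by simp
  qed
qed

text \<open>The weak identity is tested with a C1 approximation of the indicator of the interval.
  Its derivative is a difference of two tents, so one side tends to \<open>f x - f y\<close>; the
  other tends to minus the integral of \<open>g\<close> by dominated convergence. With
  \<open>x\<close> positive, the supports are compact in the open half-line.\<close>

lemma weak_derivative_diff:
  assumes f: "continuous_on {0..} f" and g: "g \<in> L2_half_line" and w: "has_weak_derivative f g"
    and xy: "0 < x" "x \<le> y"
  shows "f y - f x = integral {x..y} g"
proof -
  \<comment> \<open>All widths are at most 1, so that \<open>{x..y + 2}\<close> contains every
    support.\<close>
  define h where "h = (\<lambda>n. 1 / real (Suc n))"
  have h: "h n > 0" "h n \<le> 1" for n by (auto simp: h_def)
  define \<phi> where "\<phi> = (\<lambda>n t. step (h n) (t - x) - step (h n) (t - y))"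
  have D: "(\<phi> n has_real_derivative bump (h n) (t - x) - bump (h n) (t - y)) (at t)" for n t
    unfolding \<phi>_def using h by (intro DERIV_diff has_real_derivative_step) auto
  then have dphi: "deriv (\<phi> n) t = bump (h n) (t - x) - bump (h n) (t - y)" for n t
    by (rule DERIV_imp_deriv)
  have \<phi>0: "\<phi> n t = 0" if "t \<notin> {x..y + 2}" for n t
    using that step_left[OF h(1), of "t - x" n] step_left[OF h(1), of "t - y" n]
      step_right[OF h(1), of n "t - x"] step_right[OF h(1), of n "t - y"] xy h(2)[of n]
    by (auto simp: \<phi>_def)
  have tf: "test_function (\<phi> n)" for n
    unfolding test_function_def
  proof (intro conjI exI)
    show "\<phi> n C1_differentiable_on UNIV"
      unfolding C1_differentiable_on_def
      using D[of n] by (intro exI[of _ "\<lambda>t. bump (h n) (t - x) - bump (h n) (t - y)"])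
        (auto simp flip: has_real_derivative_iff_has_vector_derivative intro!: continuous_intros continuous_on_bump)
    show "\<forall>t. t \<notin> {x..y + 2} \<longrightarrow> \<phi> n t = 0" using \<phi>0 by blast
  qed (use xy in auto)
  have eq: "(LINT t|half_line. bump (h n) (t - x) *\<^sub>R f t) - (LINT t|half_line. bump (h n) (t - y) *\<^sub>R f t)
      = - (LINT t|half_line. \<phi> n t *\<^sub>R g t)" for n
  proof -
    have "(LINT t|half_line. bump (h n) (t - x) *\<^sub>R f t) - (LINT t|half_line. bump (h n) (t - y) *\<^sub>R f t)
      = (LINT t|half_line. bump (h n) (t - x) *\<^sub>R f t - bump (h n) (t - y) *\<^sub>R f t)"
      using xy by (intro Bochner_Integration.integral_diff[symmetric] half_line_integral(1) bump_average(1) h f) auto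
    also have "\<dots> = (LINT t|half_line. deriv (\<phi> n) t *\<^sub>R f t)"
      by (simp add: dphi scaleR_diff_left)
    finally show ?thesis using w tf by (simp add: has_weak_derivative_def)
  qed
  have lim_h: "h \<longlonglongrightarrow> 0"
    unfolding h_def using LIMSEQ_inverse_real_of_nat by (simp add: inverse_eq_divide)
  have mg[measurable]: "g \<in> borel_measurable half_line" by (rule L2_half_lineD(1)[OF g])
  have [measurable]: "(\<lambda>t. t) \<in> borel_measurable half_line"
    using id_borel_measurable_lebesgue_on[of "{0..}"] by (simp add: id_def)
  have ev1: "\<forall>\<^sub>F n in sequentially. step (h n) t = 1" if "t > 0" for t
    using order_tendstoD(2)[OF lim_h, of "t / 2"] that
    by (auto elim!: eventually_mono intro!: step_right h)
  \<comment> \<open>The pointwise limit is half-open because \<open>step\<close> vanishes at 0: it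
    is 0 at \<open>t = x\<close> and 1 at \<open>t = y\<close> if \<open>x < y\<close>. The
    restriction of \<open>norm (g t)\<close> to \<open>{0..y + 2}\<close> dominates.\<close>
  have "(\<lambda>n. LINT t|half_line. \<phi> n t *\<^sub>R g t) \<longlonglongrightarrow> (LINT t|half_line. indicator {x<..y} t *\<^sub>R g t)"
  proof (rule integral_dominated_convergence)
    show "(\<lambda>t. indicator {x<..y} t *\<^sub>R g t) \<in> borel_measurable half_line"
      by measurable
    show "(\<lambda>t. \<phi> n t *\<^sub>R g t) \<in> borel_measurable half_line" for n
    proof -
      have "\<phi> n \<in> borel_measurable borel"
        by (rule borel_measurable_continuous_onI) (meson D DERIV_isCont continuous_at_imp_continuous_on)
      then have "\<phi> n \<in> borel_measurable half_line"
        by (simp add: measurable_completion measurable_restrict_space1)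
      then show ?thesis using mg by measurable
    qed
    have "(\<lambda>t. indicator {0..y + 2} t * norm (g t)) absolutely_integrable_on {0..}"
    proof (rule absolutely_integrable_on_superset[where S = "{0..y + 2}"])
      have "(\<lambda>t. norm (g t)) absolutely_integrable_on {0..y + 2}"
        using L2_half_line_absolutely_integrable_Icc[OF g, of 0 "y + 2"] absolutely_integrable_norm by (auto simp: o_def)
      then show "(\<lambda>t. indicator {0..y + 2} t * norm (g t)) absolutely_integrable_on {0..y + 2}"
        by (rule absolutely_integrable_spike[of _ _ "{}"]) auto
    qed auto
    then show "integrable half_line (\<lambda>t. indicator {0..y + 2} t * norm (g t))"
      by (rule half_line_integral)
    show "AE t in half_line. norm (\<phi> n t *\<^sub>R g t) \<le> indicator {0..y + 2} t * norm (g t)" for n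
    proof (rule AE_I2)
      fix t assume "t \<in> space half_line"
      show "norm (\<phi> n t *\<^sub>R g t) \<le> indicator {0..y + 2} t * norm (g t)"
      proof (cases "t \<in> {x..y + 2}")
        case True
        have "\<bar>\<phi> n t\<bar> \<le> 1"
          using step_bounds[OF h(1), of n "t - x"] step_bounds[OF h(1), of n "t - y"] by (auto simp: \<phi>_def)
        then show ?thesis using True xy by (auto intro: mult_left_le_one_le)
      qed (simp add: \<phi>0)
    qed
    show "AE t in half_line. (\<lambda>n. \<phi> n t *\<^sub>R g t) \<longlonglongrightarrow> indicator {x<..y} t *\<^sub>R g t"
    proof (intro AE_I2 tendsto_scaleR tendsto_const)
      fix t assume "t \<in> space half_line"
      consider "t \<le> x" | "x < t" "t \<le> y" | "t > y" by linarith
      then show "(\<lambda>n. \<phi> n t) \<longlonglongrightarrow> indicator {x<..y} t"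
      proof cases
        case 1
        then show ?thesis using xy h by (simp add: \<phi>_def step_left)
      next
        case 2
        then have "\<forall>\<^sub>F n in sequentially. \<phi> n t = indicator {x<..y} t"
          using ev1[of "t - x"] h by (auto elim!: eventually_mono simp: \<phi>_def step_left)
        then show ?thesis by (rule tendsto_eventually)
      next
        case 3
        then have "\<forall>\<^sub>F n in sequentially. step (h n) (t - x) = 1" "\<forall>\<^sub>F n in sequentially. step (h n) (t - y) = 1"
          using ev1[of "t - x"] ev1[of "t - y"] xy by auto
        then have "\<forall>\<^sub>F n in sequentially. \<phi> n t = indicator {x<..y} t"
          by eventually_elim (use 3 in \<open>auto simp: \<phi>_def\<close>)
        then show ?thesis by (rule tendsto_eventually)
      qed
    qed
  qed
  moreover have "(LINT t|half_line. indicator {x<..y} t *\<^sub>R g t) = integral {x..y} g"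
  proof -
    have gi: "g absolutely_integrable_on {x..y}"
      by (rule L2_half_line_absolutely_integrable_Icc[OF g]) (use xy in auto)
    have 1: "((\<lambda>t. indicator {x<..y} t *\<^sub>R g t) has_integral integral {x..y} g) {x..y}"
      by (rule has_integral_spike[of "{x}" _ _ g])
        (use gi in \<open>auto simp: absolutely_integrable_on_def\<close>)
    have 2: "(\<lambda>t. indicator {x<..y} t *\<^sub>R g t) absolutely_integrable_on {x..y}"
      by (rule absolutely_integrable_spike[OF gi, of "{x}"]) auto
    have 3: "(\<lambda>t. indicator {x<..y} t *\<^sub>R g t) absolutely_integrable_on {0..}"
      by (rule absolutely_integrable_on_superset[OF 2]) (use xy in auto)
    have "((\<lambda>t. indicator {x<..y} t *\<^sub>R g t) has_integral integral {x..y} g) {0..}"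
      by (rule has_integral_on_superset[OF 1]) (use xy in auto)
    then show ?thesis
      unfolding half_line_integral(2)[OF 3] by (rule integral_unique)
  qed
  ultimately have "(\<lambda>n. - (LINT t|half_line. \<phi> n t *\<^sub>R g t)) \<longlonglongrightarrow> - integral {x..y} g"
    by (auto intro: tendsto_minus)
  moreover have "(\<lambda>n. - (LINT t|half_line. \<phi> n t *\<^sub>R g t)) \<longlonglongrightarrow> f x - f y"
    unfolding eq[symmetric] h_def
    by (intro tendsto_diff bump_average_tendsto f) (use xy in auto)
  ultimately have "f x - f y = - integral {x..y} g"
    using LIMSEQ_unique by blast
  then show ?thesis by (simp add: algebra_simps)
qed

text \<open>Test functions do not see the vertex, so the increment formula is available only from
  positive points; continuity of \<open>f\<close> at 0 extends it.\<close>

lemma weak_derivative_imp_ac_deriv: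
  assumes f: "continuous_on {0..} f" and g: "g \<in> L2_half_line" and w: "has_weak_derivative f g"
  shows "ac_deriv f g"
  unfolding ac_deriv_def
proof (intro allI impI conjI)
  fix x :: real assume x: "0 \<le> x"
  show ai: "g absolutely_integrable_on {0..x}"
    by (rule L2_half_line_absolutely_integrable_Icc[OF g]) simp
  then have gi: "g integrable_on {0..x}" by (simp add: absolutely_integrable_on_def)
  show "f x = f 0 + integral {0..x} g"
  proof (cases "x = 0")
    case False
    then have x: "x > 0" using x by simp
    \<comment> \<open>\<open>D\<close> is constant on the positive points of \<open>{0..x}\<close>
      and continuous at 0.\<close>
    define D where "D = (\<lambda>t. f t - integral {0..t} g)"
    have "continuous_on {0..x} D"
      unfolding D_def
      by (intro continuous_on_diff indefinite_integral_continuous_1 gi continuous_on_subset[OF f]) auto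
    then have "(D \<longlongrightarrow> D 0) (at 0 within {0..x})"
      using x by (auto simp: continuous_on)
    moreover have "(D \<longlongrightarrow> D x) (at 0 within {0..x})"
    proof (rule tendsto_eventually)
      show "\<forall>\<^sub>F t in at 0 within {0..x}. D t = D x"
        unfolding eventually_at
      proof (intro exI[of _ 1] conjI ballI impI; clarsimp)
        fix t assume t: "0 \<le> t" "t \<le> x" "t \<noteq> 0"
        have "f x - f t = integral {t..x} g"
          by (rule weak_derivative_diff[OF f g w]) (use t in auto)
        moreover have "integral {0..t} g + integral {t..x} g = integral {0..x} g"
          by (rule Henstock_Kurzweil_Integration.integral_combine[OF t(1,2) gi])
        ultimately show "D t = D x"
          unfolding D_def by (simp add: algebra_simps)
      qed
    qed
    moreover have "at 0 within {0..x} \<noteq> bot"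
      using x by (simp add: trivial_limit_within islimpt_Icc)
    ultimately have "D 0 = D x" using tendsto_unique by blast
    then show ?thesis by (simp add: D_def algebra_simps)
  qed simp
qed

text \<open>The product rule for \<open>\<phi> * f\<close>, integrated over an interval at both ends
  of which \<phi> vanishes. \<phi> is made complex to fit the product rule.\<close>

lemma ac_deriv_imp_weak_derivative:
  assumes f: "ac_deriv f g"
  shows "has_weak_derivative f g"
  unfolding has_weak_derivative_def
proof (intro allI impI)
  fix \<phi> assume tf: "test_function \<phi>"
  obtain D where D: "\<And>t. (\<phi> has_vector_derivative D t) (at t)" "continuous_on UNIV D"
    using tf by (auto simp: test_function_def C1_differentiable_on_def)
  obtain K where K: "compact K" "K \<subseteq> {0<..}" "\<And>t. t \<notin> K \<Longrightarrow> \<phi> t = 0"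
    using tf by (auto simp: test_function_def)
  obtain R where R: "\<And>t. t \<in> K \<Longrightarrow> \<bar>t\<bar> \<le> R" "R > 0"
    using compact_imp_bounded[OF K(1)] by (auto simp: bounded_pos)
  have dphi: "deriv \<phi> = D"
    using D(1) by (auto simp: fun_eq_iff has_real_derivative_iff_has_vector_derivative intro!: DERIV_imp_deriv)
  have \<phi>0: "\<phi> t = 0" if "t > R \<or> t \<le> 0" for t
  proof -
    have "t \<notin> K" using K(2) R(1)[of t] that by auto
    then show ?thesis by (rule K(3))
  qed
  have D0: "D t = 0" if "t \<notin> {0..R}" for t
  proof -
    have "(\<phi> has_vector_derivative 0) (at t)"
      by (rule has_vector_derivative_transform_within_open[of "\<lambda>_. 0" _ _ "- {0..R}"]) (use that \<phi>0 in auto)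
    then show ?thesis using D(1) vector_derivative_unique_at by blast
  qed
  have "ac_deriv \<phi> D"
    by (rule ac_deriv_of_vector_derivative)
      (use D in \<open>auto intro: has_vector_derivative_at_within continuous_on_subset\<close>)
  then have ac\<phi>: "ac_deriv (\<lambda>t. complex_of_real (\<phi> t)) (\<lambda>t. complex_of_real (D t))"
    by (rule ac_deriv_linear) (rule bounded_linear_of_real)
  note ac = ac_deriv_mult[OF this f]
  define F where "F = (\<lambda>t. D t *\<^sub>R f t)"
  define G where "G = (\<lambda>t. \<phi> t *\<^sub>R g t)"
  have c\<phi>: "continuous_on A \<phi>" for A
    by (meson D(1) continuous_at_imp_continuous_on has_vector_derivative_continuous)
  \<comment> \<open>The endpoint is \<open>R + 1\<close> because \<phi> is known to vanish only
    strictly beyond \<open>R\<close>.\<close>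
  have F1: "F absolutely_integrable_on {0..R + 1}"
    unfolding F_def
    by (intro absolutely_integrable_continuous_real continuous_intros
          continuous_on_subset[OF D(2)] continuous_on_subset[OF ac_deriv_continuous_on[OF f]]) auto
  have G1: "G absolutely_integrable_on {0..R + 1}"
    unfolding G_def scaleR_conv_of_real
    by (intro absolutely_integrable_mult_continuous ac_deriv_absolutely_integrable[OF f]
          continuous_intros c\<phi>) auto
  have F0: "F t = 0" and G0: "G t = 0" if "t \<notin> {0..R + 1}" for t
    using D0[of t] \<phi>0[of t] that by (auto simp: F_def G_def)
  have F2: "F absolutely_integrable_on {0..}"
    by (rule absolutely_integrable_on_superset[OF F1]) (auto intro: F0)
  have G2: "G absolutely_integrable_on {0..}"
    by (rule absolutely_integrable_on_superset[OF G1]) (auto intro: G0)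
  have IF: "integral {0..} F = integral {0..R + 1} F"
    by (rule integral_unique[OF has_integral_on_superset[of _ _ "{0..R + 1}"]])
      (use F1 F0 in \<open>auto simp: absolutely_integrable_on_def\<close>)
  have IG: "integral {0..} G = integral {0..R + 1} G"
    by (rule integral_unique[OF has_integral_on_superset[of _ _ "{0..R + 1}"]])
      (use G1 G0 in \<open>auto simp: absolutely_integrable_on_def\<close>)
  have "integral {0..R + 1} (\<lambda>t. F t + G t) = 0"
    using ac_deriv_eq[OF ac, of "R + 1"] \<phi>0 R(2) by (simp add: F_def G_def scaleR_conv_of_real)
  then have "integral {0..R + 1} F + integral {0..R + 1} G = 0"
    using F1 G1 by (subst Henstock_Kurzweil_Integration.integral_add[symmetric]) (auto simp: absolutely_integrable_on_def)
  then show "(LINT x|half_line. deriv \<phi> x *\<^sub>R f x) = - (LINT x|half_line. \<phi> x *\<^sub>R g x)"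
    unfolding dphi F_def[symmetric] G_def[symmetric] half_line_integral(2)[OF F2] half_line_integral(2)[OF G2] IF IG
    by (simp only: eq_neg_iff_add_eq_0)
qed

text \<open>The difference of two derivatives, extended by zero to the whole line, has integral zero
  over every interval and so vanishes almost everywhere.\<close>

lemma ac_deriv_unique:
  assumes "ac_deriv f g" "ac_deriv f g'"
  shows "negligible {x. 0 \<le> x \<and> g x \<noteq> g' x}"
proof -
  define k where "k = (\<lambda>x. if x \<in> {0..} then g x - g' x else 0)"
  have d: "((\<lambda>x. g x - g' x) has_integral 0) {x..y}" if "0 \<le> x" for x y
  proof (cases "x \<le> y")
    case True
    have "((\<lambda>x. g x - g' x) has_integral (f y - f x) - (f y - f x)) {x..y}"
      using ac_deriv_diff[OF assms(1) that True] ac_deriv_diff[OF assms(2) that True]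
        ac_deriv_integrable[OF assms(1) that] ac_deriv_integrable[OF assms(2) that]
      by (intro has_integral_diff) (auto simp: has_integral_iff)
    then show ?thesis by simp
  qed auto
  have k: "(k has_integral 0) (cbox x y)" for x y
  proof -
    have "{0..} \<inter> {x..y} = {max 0 x..y}" by auto
    then have "((\<lambda>x. g x - g' x) has_integral 0) ({0..} \<inter> cbox x y)"
      using d[of "max 0 x" y] by simp
    then show ?thesis unfolding k_def by (subst has_integral_restrict_Int)
  qed
  then have "k integrable_on cbox x y" for x y by blast
  \<comment> \<open>\<open>N\<close> is the exceptional set of Lebesgue's differentiation theorem:
    elsewhere \<open>k x\<close> is the limit of averages over \<open>[x, x + h]\<close>, and these
    are all zero.\<close>
  then obtain N where N: "negligible N"
    "\<And>x e. \<lbrakk>x \<notin> N; 0 < e\<rbrakk> \<Longrightarrow> \<exists>d>0. \<forall>h. 0 < h \<and> h < d \<longrightarrow>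
       norm (integral (cbox x (x + h *\<^sub>R One)) k /\<^sub>R h ^ DIM(real) - k x) < e"
    by (rule integrable_ccontinuous_explicit[of k]) blast
  have "k x = 0" if x: "x \<notin> N" for x
  proof (rule ccontr)
    assume "k x \<noteq> 0"
    then obtain d where "d > 0" "\<And>h. 0 < h \<Longrightarrow> h < d \<Longrightarrow>
       norm (integral (cbox x (x + h *\<^sub>R One)) k /\<^sub>R h ^ DIM(real) - k x) < norm (k x)"
      using N(2)[OF x, of "norm (k x)"] by auto
    from this(2)[of "d / 2"] this(1) show False
      using integral_unique[OF k[of x "x + (d / 2) *\<^sub>R One"]] by simp
  qed
  then have "{x. 0 \<le> x \<and> g x \<noteq> g' x} \<subseteq> N"
    unfolding k_def by (auto split: if_splits) (metis atLeast_iff eq_iff_diff_eq_0)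
  then show ?thesis using N(1) negligible_subset by blast
qed

section \<open>The calibration identity on an edge\<close>

text \<open>Frees \<open>weak_deriv\<close> from the choice operator: the chosen function is square
  integrable and has \<open>f\<close> as a primitive.\<close>

lemma H1_half_lineD:
  assumes "f \<in> H1_half_line"
  shows "f \<in> extensional {0..}" "f \<in> L2_half_line" "weak_deriv f \<in> L2_half_line" "ac_deriv f (weak_deriv f)"
proof -
  have f: "f \<in> extensional {0..}" "continuous_on {0..} f" "f \<in> L2_half_line"
    and ex: "\<exists>g. g \<in> L2_half_line \<and> has_weak_derivative f g"
    using assms by (auto simp: H1_half_line_def)
  show "f \<in> extensional {0..}" "f \<in> L2_half_line" by fact+
  have w: "weak_deriv f \<in> L2_half_line \<and> has_weak_derivative f (weak_deriv f)"
    unfolding weak_deriv_def by (rule someI_ex[OF ex])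
  then show "weak_deriv f \<in> L2_half_line" by simp
  show "ac_deriv f (weak_deriv f)"
    using w f by (intro weak_derivative_imp_ac_deriv) auto
qed

text \<open>Product rule for \<open>f x * cnj (f x)\<close>, followed by the real part.\<close>

lemma ac_deriv_norm_squared:
  fixes f g :: "real \<Rightarrow> complex"
  assumes "ac_deriv f g"
  shows "ac_deriv (\<lambda>x. (norm (f x))\<^sup>2) (\<lambda>x. 2 * (f x \<bullet> g x))"
proof -
  have "ac_deriv (\<lambda>x. f x * cnj (f x)) (\<lambda>x. g x * cnj (f x) + f x * cnj (g x))"
    by (rule ac_deriv_mult[OF assms ac_deriv_linear[OF assms bounded_linear_cnj]])
  from ac_deriv_linear[OF this bounded_linear_Re]
  show ?thesis
    unfolding cmod_power2 inner_complex_def by (simp add: power2_eq_square algebra_simps)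
qed

lemma absolutely_integrable_mult_bounded:
  fixes h k :: "real \<Rightarrow> real"
  assumes "k absolutely_integrable_on {0..}" "continuous_on {0..} h" "\<And>x. 0 \<le> x \<Longrightarrow> \<bar>h x\<bar> \<le> B"
  shows "(\<lambda>x. h x * k x) absolutely_integrable_on {0..}"
proof (rule absolutely_integrable_bounded_measurable_product_real[OF _ _ _ assms(1)])
  show "h \<in> borel_measurable half_line"
    by (rule continuous_imp_measurable_on_sets_lebesgue[OF assms(2)]) auto
  show "bounded (h ` {0..})"
    unfolding bounded_iff using assms(3) by auto
qed auto

text \<open>One edge of the graph, with cubic coefficient \<open>1 / r\<close>. The parameter
  \<open>y\<close>, the value of \<open>T\<close> at the vertex, stays free here; on the graph it is
  adjusted so that \<open>T\<close> has a prescribed limit.\<close>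

locale half_line_H1 =
  fixes f g :: "real \<Rightarrow> complex" and r y :: real
  assumes r: "0 < r" and ac: "ac_deriv f g" and f: "f \<in> L2_half_line" and g: "g \<in> L2_half_line"
begin

text \<open>For the ground state profile this is minus the logarithmic derivative,
  \<open>k * tanh (k * x + A)\<close>; for a general \<open>f\<close> it is reconstructed from the
  mass distribution.\<close>

definition T :: "real \<Rightarrow> real" where
  "T x = y + integral {0..x} (\<lambda>t. (norm (f t))\<^sup>2 / (2 * r))"

definition \<kappa> :: real where
  "\<kappa> = y + integral {0..} (\<lambda>t. (norm (f t))\<^sup>2) / (2 * r)"

section \<open>Integrability and decay on one edge\<close>

lemma Q_ai: "(\<lambda>x. (norm (f x))\<^sup>2) absolutely_integrable_on {0..}"
  by (rule L2_half_lineD(2)[OF f])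

lemma g2_ai: "(\<lambda>x. (norm (g x))\<^sup>2) absolutely_integrable_on {0..}"
  by (rule L2_half_lineD(2)[OF g])

lemma f_cont: "continuous_on {0..} f"
  by (rule ac_deriv_continuous_on[OF ac])

lemma inner_ai: "(\<lambda>x. f x \<bullet> g x) absolutely_integrable_on {0..}"
proof (rule measurable_bounded_by_integrable_imp_absolutely_integrable)
  show "(\<lambda>x. f x \<bullet> g x) \<in> borel_measurable half_line"
    using L2_half_lineD(1)[OF f] L2_half_lineD(1)[OF g] by (rule borel_measurable_inner)
  show "(\<lambda>x. (norm (f x))\<^sup>2 + (norm (g x))\<^sup>2) integrable_on {0..}"
    using Q_ai g2_ai by (intro integrable_add) (auto simp: absolutely_integrable_on_def)
  fix x
  have "norm (f x \<bullet> g x) \<le> norm (f x) * norm (g x)"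
    using Cauchy_Schwarz_ineq2[of "f x" "g x"] by simp
  also have "\<dots> \<le> (norm (f x))\<^sup>2 + (norm (g x))\<^sup>2"
    using sum_squares_bound[of "norm (f x)" "norm (g x)"]
      mult_nonneg_nonneg[OF norm_ge_zero[of "f x"] norm_ge_zero[of "g x"]]
    unfolding mult.assoc by linarith
  finally show "norm (f x \<bullet> g x) \<le> (norm (f x))\<^sup>2 + (norm (g x))\<^sup>2" .
qed auto

text \<open>The derivative \<open>2 * (f x \<bullet> g x)\<close> is integrable, so a limit exists;
  integrability of the squared norm forces it to be zero.\<close>

lemma Q_tendsto: "((\<lambda>x. (norm (f x))\<^sup>2) \<longlongrightarrow> 0) at_top"
proof -
  have "(\<lambda>x. 2 * (f x \<bullet> g x)) absolutely_integrable_on {0..}"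
    using inner_ai by (rule set_integrable_mult_right)
  from ac_deriv_tendsto[OF ac_deriv_norm_squared[OF ac] this] obtain L
    where L: "((\<lambda>x. (norm (f x))\<^sup>2) \<longlongrightarrow> L) at_top" by blast
  have "L = 0"
    by (rule integrable_nonneg_limit_zero[OF _ _ L]) (use Q_ai in \<open>auto simp: absolutely_integrable_on_def\<close>)
  then show ?thesis using L by simp
qed

lemma Q_bounded: obtains B where "\<And>x. 0 \<le> x \<Longrightarrow> (norm (f x))\<^sup>2 \<le> B"
proof -
  obtain R where R: "\<And>x. x \<ge> R \<Longrightarrow> (norm (f x))\<^sup>2 < 1"
    using order_tendstoD(2)[OF Q_tendsto, of 1] by (auto simp: eventually_at_top_linorder)
  have "compact ((\<lambda>x. (norm (f x))\<^sup>2) ` {0..R})"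
    by (intro compact_continuous_image continuous_intros continuous_on_subset[OF f_cont]) auto
  then obtain B where B: "\<And>x. x \<in> {0..R} \<Longrightarrow> (norm (f x))\<^sup>2 \<le> B"
    by (force dest!: compact_imp_bounded simp: bounded_iff)
  show thesis
  proof (rule that[of "max B 1"])
    fix x :: real assume "0 \<le> x"
    then show "(norm (f x))\<^sup>2 \<le> max B 1"
      using B[of x] R[of x] by (cases "x \<le> R") auto
  qed
qed

lemma Q_cont: "continuous_on {0..} (\<lambda>x. (norm (f x))\<^sup>2)"
  by (intro continuous_intros f_cont)

lemma quartic_ai: "(\<lambda>x. norm (f x) ^ 4) absolutely_integrable_on {0..}"
proof -
  obtain B where B: "\<And>x. 0 \<le> x \<Longrightarrow> (norm (f x))\<^sup>2 \<le> B" by (rule Q_bounded) blast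
  have "(\<lambda>x. (norm (f x))\<^sup>2 * (norm (f x))\<^sup>2) absolutely_integrable_on {0..}"
    by (rule absolutely_integrable_mult_bounded[OF Q_ai Q_cont, of B]) (use B in auto)
  then show ?thesis by (simp flip: power_add)
qed

section \<open>The calibrating function and its integral identities\<close>

lemma T_ac: "ac_deriv T (\<lambda>x. (norm (f x))\<^sup>2 / (2 * r))"
proof -
  have "T 0 = y" by (simp add: T_def)
  moreover have "(\<lambda>t. (norm (f t))\<^sup>2 / (2 * r)) absolutely_integrable_on {0..x}" for x
    using r by (intro absolutely_integrable_continuous_real continuous_intros continuous_on_subset[OF f_cont]) auto
  ultimately show ?thesis
    unfolding ac_deriv_def by (auto simp: T_def)
qed

lemma T_0: "T 0 = y"
  by (simp add: T_def)

lemma T_cont: "continuous_on {0..} T"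
  by (rule ac_deriv_continuous_on[OF T_ac])

lemma T_deriv: "0 \<le> x \<Longrightarrow> (T has_real_derivative (norm (f x))\<^sup>2 / (2 * r)) (at x within {0..})"
  using r by (intro ac_deriv_has_real_derivative[OF T_ac] continuous_intros f_cont) auto

lemma T_tendsto: "(T \<longlongrightarrow> \<kappa>) at_top"
proof -
  have "(\<lambda>x. (norm (f x))\<^sup>2 / (2 * r)) absolutely_integrable_on {0..}"
    using Q_ai by (rule set_integrable_divide)
  from ac_deriv_tendsto[OF T_ac this] show ?thesis
    by (simp add: T_0 \<kappa>_def)
qed

lemma T_bounds: assumes "0 \<le> x" shows "y \<le> T x" "T x \<le> \<kappa>"
proof -
  have mono: "T s \<le> T t" if "0 \<le> s" "s \<le> t" for s t
    using ac_deriv_diff[OF T_ac that] integral_nonneg[OF ac_deriv_integrable[OF T_ac that(1)], of t] r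
    by simp
  show "y \<le> T x" using mono[of 0 x] assms by (simp add: T_0)
  have "\<forall>\<^sub>F t in at_top. T x \<le> T t"
    using eventually_ge_at_top[of x] by eventually_elim (use mono assms in auto)
  then show "T x \<le> \<kappa>"
    by (intro tendsto_lowerbound[OF T_tendsto]) auto
qed

lemma T_bounded: "0 \<le> x \<Longrightarrow> \<bar>T x\<bar> \<le> \<bar>y\<bar> + \<bar>\<kappa>\<bar>"
  using T_bounds[of x] by linarith

text \<open>Since the squared norm of \<open>f\<close> is \<open>2 * r\<close> times the derivative
  of \<open>T\<close>, the integrand is the derivative of
  \<open>2 * r / 3 * T x ^ 3\<close>.\<close>

lemma TQ_integral:
  "(\<lambda>x. (T x)\<^sup>2 * (norm (f x))\<^sup>2) absolutely_integrable_on {0..}"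
  "integral {0..} (\<lambda>x. (T x)\<^sup>2 * (norm (f x))\<^sup>2) = 2 * r / 3 * (\<kappa> ^ 3 - y ^ 3)"
proof -
  show ai: "(\<lambda>x. (T x)\<^sup>2 * (norm (f x))\<^sup>2) absolutely_integrable_on {0..}"
  proof (rule absolutely_integrable_mult_bounded[OF Q_ai, of _ "(\<bar>y\<bar> + \<bar>\<kappa>\<bar>)\<^sup>2"])
    show "continuous_on {0..} (\<lambda>x. (T x)\<^sup>2)" by (intro continuous_intros T_cont)
    show "\<bar>(T x)\<^sup>2\<bar> \<le> (\<bar>y\<bar> + \<bar>\<kappa>\<bar>)\<^sup>2" if "0 \<le> x" for x
      using power_mono[OF T_bounded[OF that] abs_ge_zero, of 2] by simp
  qed
  have "ac_deriv (\<lambda>x. 2 * r / 3 * T x ^ 3) (\<lambda>x. (T x)\<^sup>2 * (norm (f x))\<^sup>2)"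
  proof (rule ac_deriv_of_vector_derivative)
    fix x :: real assume "0 \<le> x"
    then have "((\<lambda>x. 2 * r / 3 * T x ^ 3) has_real_derivative (T x)\<^sup>2 * (norm (f x))\<^sup>2) (at x within {0..})"
      using r by (auto intro!: derivative_eq_intros T_deriv simp: power2_eq_square)
    then show "((\<lambda>x. 2 * r / 3 * T x ^ 3) has_vector_derivative (T x)\<^sup>2 * (norm (f x))\<^sup>2) (at x within {0..})"
      by (simp add: has_real_derivative_iff_has_vector_derivative)
  qed (intro continuous_intros T_cont f_cont)
  from ac_deriv_tendsto[OF this ai]
  have "((\<lambda>x. 2 * r / 3 * T x ^ 3) \<longlongrightarrow> 2 * r / 3 * y ^ 3 + integral {0..} (\<lambda>x. (T x)\<^sup>2 * (norm (f x))\<^sup>2)) at_top"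
    by (simp add: T_0)
  moreover have "((\<lambda>x. 2 * r / 3 * T x ^ 3) \<longlongrightarrow> 2 * r / 3 * \<kappa> ^ 3) at_top"
    by (intro tendsto_intros T_tendsto)
  ultimately have "2 * r / 3 * y ^ 3 + integral {0..} (\<lambda>x. (T x)\<^sup>2 * (norm (f x))\<^sup>2) = 2 * r / 3 * \<kappa> ^ 3"
    by (rule tendsto_unique[rotated]) simp
  then show "integral {0..} (\<lambda>x. (T x)\<^sup>2 * (norm (f x))\<^sup>2) = 2 * r / 3 * (\<kappa> ^ 3 - y ^ 3)"
    by (simp add: algebra_simps)
qed

text \<open>Integration by parts of \<open>T\<close> against the derivative of the squared norm. The
  term with the derivative of \<open>T\<close> produces the quartic integral, and the boundary term
  at infinity vanishes because \<open>T\<close> is bounded and \<open>f\<close> decays.\<close>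

lemma T_inner_integral:
  "(\<lambda>x. T x * (f x \<bullet> g x)) absolutely_integrable_on {0..}"
  "2 * integral {0..} (\<lambda>x. T x * (f x \<bullet> g x)) = - y * (norm (f 0))\<^sup>2 - integral {0..} (\<lambda>x. norm (f x) ^ 4) / (2 * r)"
proof -
  show ai: "(\<lambda>x. T x * (f x \<bullet> g x)) absolutely_integrable_on {0..}"
    by (rule absolutely_integrable_mult_bounded[OF inner_ai T_cont T_bounded])
  define G where "G = (\<lambda>x. 2 * (T x * (f x \<bullet> g x)) + norm (f x) ^ 4 / (2 * r))"
  have "ac_deriv (\<lambda>x. T x * (norm (f x))\<^sup>2) (\<lambda>x. (norm (f x))\<^sup>2 / (2 * r) * (norm (f x))\<^sup>2 + T x * (2 * (f x \<bullet> g x)))"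
    by (rule ac_deriv_mult[OF T_ac ac_deriv_norm_squared[OF ac]])
  also have "(\<lambda>x. (norm (f x))\<^sup>2 / (2 * r) * (norm (f x))\<^sup>2 + T x * (2 * (f x \<bullet> g x))) = G"
    by (simp add: G_def fun_eq_iff algebra_simps flip: power_add)
  finally have acG: "ac_deriv (\<lambda>x. T x * (norm (f x))\<^sup>2) G" .
  have aiG: "G absolutely_integrable_on {0..}"
    unfolding G_def by (intro set_integral_add set_integrable_mult_right set_integrable_divide ai quartic_ai)
  have "((\<lambda>x. T x * (norm (f x))\<^sup>2) \<longlongrightarrow> y * (norm (f 0))\<^sup>2 + integral {0..} G) at_top"
    using ac_deriv_tendsto[OF acG aiG] by (simp add: T_0)
  moreover have "((\<lambda>x. T x * (norm (f x))\<^sup>2) \<longlongrightarrow> \<kappa> * 0) at_top"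
    by (intro tendsto_intros T_tendsto Q_tendsto)
  ultimately have "y * (norm (f 0))\<^sup>2 + integral {0..} G = \<kappa> * 0"
    by (rule tendsto_unique[rotated]) simp
  moreover have "integral {0..} G = 2 * integral {0..} (\<lambda>x. T x * (f x \<bullet> g x)) + integral {0..} (\<lambda>x. norm (f x) ^ 4) / (2 * r)"
    unfolding G_def using ai set_integrable_divide[OF quartic_ai, of "2 * r"]
    by (subst Henstock_Kurzweil_Integration.integral_add) (auto simp: absolutely_integrable_on_def)
  ultimately show "2 * integral {0..} (\<lambda>x. T x * (f x \<bullet> g x)) = - y * (norm (f 0))\<^sup>2 - integral {0..} (\<lambda>x. norm (f x) ^ 4) / (2 * r)"
    by (simp add: algebra_simps)
qed

text \<open>Expanding the square leaves the kinetic term, a mixed term and a cubic boundary term;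
  the last two are given by the two preceding integral identities.\<close>

lemma calibration:
  "(\<lambda>x. (norm (g x + T x *\<^sub>R f x))\<^sup>2) absolutely_integrable_on {0..}"
  "integral {0..} (\<lambda>x. (norm (g x))\<^sup>2) - integral {0..} (\<lambda>x. norm (f x) ^ 4) / (2 * r)
    = integral {0..} (\<lambda>x. (norm (g x + T x *\<^sub>R f x))\<^sup>2) + y * (norm (f 0))\<^sup>2 - 2 * r / 3 * (\<kappa> ^ 3 - y ^ 3)"
proof -
  have eq: "(norm (g x + T x *\<^sub>R f x))\<^sup>2 = (norm (g x))\<^sup>2 + 2 * (T x * (f x \<bullet> g x)) + (T x)\<^sup>2 * (norm (f x))\<^sup>2" for x
    unfolding power2_norm_eq_inner
    by (simp add: inner_add_left inner_add_right inner_commute power2_eq_square)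
  show "(\<lambda>x. (norm (g x + T x *\<^sub>R f x))\<^sup>2) absolutely_integrable_on {0..}"
    unfolding eq by (intro set_integral_add set_integrable_mult_right g2_ai T_inner_integral(1) TQ_integral(1))
  have "integral {0..} (\<lambda>x. (norm (g x + T x *\<^sub>R f x))\<^sup>2) = integral {0..} (\<lambda>x. (norm (g x))\<^sup>2)
     + 2 * integral {0..} (\<lambda>x. T x * (f x \<bullet> g x)) + integral {0..} (\<lambda>x. (T x)\<^sup>2 * (norm (f x))\<^sup>2)"
    unfolding eq using g2_ai T_inner_integral(1) TQ_integral(1)
    by (subst Henstock_Kurzweil_Integration.integral_add;
        (subst Henstock_Kurzweil_Integration.integral_add)?) (auto simp: absolutely_integrable_on_def intro!: integrable_add)
  then show "integral {0..} (\<lambda>x. (norm (g x))\<^sup>2) - integral {0..} (\<lambda>x. norm (f x) ^ 4) / (2 * r)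
    = integral {0..} (\<lambda>x. (norm (g x + T x *\<^sub>R f x))\<^sup>2) + y * (norm (f 0))\<^sup>2 - 2 * r / 3 * (\<kappa> ^ 3 - y ^ 3)"
    unfolding TQ_integral(2) T_inner_integral(2) by (simp add: algebra_simps)
qed

text \<open>A vanishing residual gives \<open>g = - T f\<close> almost everywhere, and the
  right-hand side is continuous, so it is the classical derivative of \<open>f\<close>.\<close>

lemma residual_zero_imp_derivative:
  assumes "integral {0..} (\<lambda>x. (norm (g x + T x *\<^sub>R f x))\<^sup>2) = 0" "0 \<le> x"
  shows "(f has_vector_derivative - (T x *\<^sub>R f x)) (at x within {0..})"
proof -
  define h where "h = (\<lambda>x. - (T x *\<^sub>R f x))"
  have hc: "continuous_on {0..} h"
    unfolding h_def by (intro continuous_intros T_cont f_cont)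
  have "(LINT x|half_line. (norm (g x + T x *\<^sub>R f x))\<^sup>2) = 0"
    unfolding half_line_integral(2)[OF calibration(1)] by (rule assms(1))
  then have "AE x in half_line. (norm (g x + T x *\<^sub>R f x))\<^sup>2 = 0"
    by (subst (asm) integral_nonneg_eq_0_iff_AE[OF half_line_integral(1)[OF calibration(1)]]) auto
  then have "AE x in lebesgue. x \<in> {0..} \<longrightarrow> g x = h x"
    by (subst (asm) AE_restrict_space_iff) (auto simp: h_def eq_neg_iff_add_eq_0)
  then have N: "negligible {x. \<not> (x \<in> {0..} \<longrightarrow> g x = h x)}"
    by (simp only: completion.AE_iff_null_sets negligible_iff_null_sets space_completion space_lborel space_borel UNIV_I simp_thms)
  have "ac_deriv f h"
    unfolding ac_deriv_def
  proof (intro allI impI conjI)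
    fix x :: real assume x: "0 \<le> x"
    show "h absolutely_integrable_on {0..x}"
      by (intro absolutely_integrable_continuous_real continuous_on_subset[OF hc]) auto
    have "integral {0..x} g = integral {0..x} h"
      by (rule integral_spike[OF N]) auto
    then show "f x = f 0 + integral {0..x} h"
      using ac_deriv_eq[OF ac x] by simp
  qed
  from ac_deriv_has_vector_derivative[OF this hc assms(2)] show ?thesis
    by (simp add: h_def)
qed

text \<open>The system \<open>f' = - T f\<close>, \<open>T' = norm f ^ 2 / (2 * r)\<close> has a
  first integral, whose value is read off at infinity. This leaves a Riccati equation for
  \<open>T\<close>, solved by a hyperbolic tangent, and then a linear equation for
  \<open>f\<close>.\<close>

lemma residual_zero_imp_sech:
  assumes res: "integral {0..} (\<lambda>x. (norm (g x + T x *\<^sub>R f x))\<^sup>2) = 0"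
    and A: "y = \<kappa> * tanh A"
  shows "0 \<le> x \<Longrightarrow> f x = f 0 * complex_of_real (cosh A) / complex_of_real (cosh (\<kappa> * x + A))"
    and "(norm (f 0))\<^sup>2 = 2 * r * (\<kappa>\<^sup>2 - y\<^sup>2)"
proof -
  note df = residual_zero_imp_derivative[OF res]
  have const: "F x = F 0" if "\<And>x. 0 \<le> x \<Longrightarrow> (F has_vector_derivative 0) (at x within {0..})" "0 \<le> x"
    for F :: "real \<Rightarrow> 'b::real_normed_vector" and x
    by (rule has_vector_derivative_zero_constant[of "{0..}" F]) (use that in auto)
  have constr: "F x = F 0" if "\<And>x. 0 \<le> x \<Longrightarrow> (F has_real_derivative 0) (at x within {0..})" "0 \<le> x"
    for F :: "real \<Rightarrow> real" and x
    by (rule const) (use that in \<open>auto simp: has_real_derivative_iff_has_vector_derivative\<close>)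
  have dQ: "((\<lambda>x. (norm (f x))\<^sup>2) has_real_derivative - 2 * T x * (norm (f x))\<^sup>2) (at x within {0..})" if "0 \<le> x" for x
  proof -
    have c: "continuous_on {0..} (\<lambda>x. - (T x *\<^sub>R f x))"
      by (intro continuous_intros T_cont f_cont)
    have "ac_deriv f (\<lambda>x. - (T x *\<^sub>R f x))"
      by (rule ac_deriv_of_vector_derivative[OF df c])
    from ac_deriv_norm_squared[OF this]
    have "((\<lambda>x. (norm (f x))\<^sup>2) has_real_derivative 2 * (f x \<bullet> (- (T x *\<^sub>R f x)))) (at x within {0..})"
      by (rule ac_deriv_has_real_derivative) (use that in \<open>auto intro!: continuous_intros T_cont f_cont\<close>)
    then show ?thesis by (simp add: power2_norm_eq_inner mult.assoc)
  qed
  define q where "q = (\<lambda>x. (norm (f x))\<^sup>2)"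
  \<comment> \<open>The first integral: both parts of its derivative equal \<open>T * q / r\<close>
    up to opposite signs.\<close>
  define V where "V = (\<lambda>x. q x / (2 * r) - (\<kappa>\<^sup>2 - (T x)\<^sup>2))"
  have dq: "(q has_real_derivative - 2 * T x * q x) (at x within {0..})"
    and dT: "(T has_real_derivative q x / (2 * r)) (at x within {0..})" if "0 \<le> x" for x
    using dQ[OF that] T_deriv[OF that] by (simp_all add: q_def)
  have V: "V x = V 0" if "0 \<le> x" for x
  proof (rule constr[OF _ that])
    fix x :: real assume x: "0 \<le> x"
    show "(V has_real_derivative 0) (at x within {0..})"
      unfolding V_def using r
      by (auto intro!: derivative_eq_intros dq[OF x] dT[OF x] simp: field_simps)
  qed
  have "(V \<longlongrightarrow> 0 / (2 * r) - (\<kappa>\<^sup>2 - \<kappa>\<^sup>2)) at_top"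
    unfolding V_def q_def by (intro tendsto_intros Q_tendsto T_tendsto) (use r in auto)
  moreover have "(V \<longlongrightarrow> V 0) at_top"
    by (rule tendsto_eventually) (rule eventually_mono[OF eventually_ge_at_top[of 0] V])
  ultimately have "V 0 = 0 / (2 * r) - (\<kappa>\<^sup>2 - \<kappa>\<^sup>2)"
    by (rule tendsto_unique[OF trivial_limit_at_top_linorder, rotated])
  then have V0: "V 0 = 0" by simp
  then have Riccati: "(norm (f x))\<^sup>2 / (2 * r) = \<kappa>\<^sup>2 - (T x)\<^sup>2" if "0 \<le> x" for x
    using V[OF that] unfolding V0 by (simp add: V_def q_def)
  define \<theta> where "\<theta> = (\<lambda>x. \<kappa> * x + A)"
  \<comment> \<open>\<open>W = 0\<close> says that \<open>T\<close> equals
    \<open>\<kappa> * tanh (\<theta> x)\<close>. By the Riccati equation \<open>W\<close> solves a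
    linear homogeneous equation, so an explicit integrating factor replaces a uniqueness
    theorem.\<close>
  define W where "W = (\<lambda>x. T x * cosh (\<theta> x) - \<kappa> * sinh (\<theta> x))"
  have d\<theta>: "(\<theta> has_real_derivative \<kappa>) (at x within S)" for x S
    unfolding \<theta>_def by (auto intro!: derivative_eq_intros)
  have dcosh: "((\<lambda>x. cosh (\<theta> x)) has_real_derivative \<kappa> * sinh (\<theta> x)) (at x within S)" for x S
    by (auto intro!: derivative_eq_intros d\<theta>)
  \<comment> \<open>\<open>exp (F x)\<close> is the integrating factor for
    \<open>W' = - T W\<close>.\<close>
  define F where "F = (\<lambda>x. integral {0..x} T)"
  have "ac_deriv F T"
    unfolding ac_deriv_def F_def
    by (auto intro!: absolutely_integrable_continuous_real continuous_on_subset[OF T_cont])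
  then have dF: "(F has_real_derivative T x) (at x within {0..})" if "0 \<le> x" for x
    by (rule ac_deriv_has_real_derivative[OF _ T_cont that])
  have dW: "(W has_real_derivative - T x * W x) (at x within {0..})" if x: "0 \<le> x" for x
  proof -
    have "(W has_real_derivative ((\<kappa>\<^sup>2 - (T x)\<^sup>2) * cosh (\<theta> x) + T x * (\<kappa> * sinh (\<theta> x))
         - \<kappa> * (\<kappa> * cosh (\<theta> x)))) (at x within {0..})"
      unfolding W_def Riccati[OF x, symmetric]
      by (auto intro!: derivative_eq_intros T_deriv[OF x] d\<theta>)
    then show ?thesis by (simp add: W_def algebra_simps power2_eq_square)
  qed
  have W0: "W x = 0" if "0 \<le> x" for x
  proof -
    have "W x * exp (F x) = W 0 * exp (F 0)"
    proof (rule constr[OF _ that])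
      fix x :: real assume x: "0 \<le> x"
      show "((\<lambda>x. W x * exp (F x)) has_real_derivative 0) (at x within {0..})"
        by (auto intro!: derivative_eq_intros dW[OF x] dF[OF x] simp: algebra_simps)
    qed
    \<comment> \<open>The initial condition is the choice of \<open>A\<close>.\<close>
    moreover have "W 0 = 0"
      unfolding W_def \<theta>_def T_0 using A less_imp_neq[OF cosh_real_pos[of A]]
      by (simp add: tanh_def nonzero_eq_divide_eq)
    ultimately show ?thesis by simp
  qed
  show "(norm (f 0))\<^sup>2 = 2 * r * (\<kappa>\<^sup>2 - y\<^sup>2)"
    using Riccati[of 0] r by (simp add: T_0 field_simps)
  assume x: "0 \<le> x"
  have "cosh (\<theta> x) *\<^sub>R f x = cosh (\<theta> 0) *\<^sub>R f 0"
  proof (rule const[OF _ x])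
    fix x :: real assume x: "0 \<le> x"
    have "((\<lambda>x. cosh (\<theta> x) *\<^sub>R f x) has_vector_derivative
        cosh (\<theta> x) *\<^sub>R (- (T x *\<^sub>R f x)) + (\<kappa> * sinh (\<theta> x)) *\<^sub>R f x) (at x within {0..})"
      by (rule has_vector_derivative_scaleR[OF dcosh df[OF x]])
    also have "cosh (\<theta> x) *\<^sub>R (- (T x *\<^sub>R f x)) + (\<kappa> * sinh (\<theta> x)) *\<^sub>R f x = - W x *\<^sub>R f x"
      by (simp add: W_def algebra_simps)
    finally show "((\<lambda>x. cosh (\<theta> x) *\<^sub>R f x) has_vector_derivative 0) (at x within {0..})"
      by (simp add: W0[OF x])
  qed
  moreover have "cosh (\<kappa> * x + A) \<noteq> 0" using cosh_real_pos[of "\<kappa> * x + A"] by linarith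
  ultimately show "f x = f 0 * complex_of_real (cosh A) / complex_of_real (cosh (\<kappa> * x + A))"
    by (simp add: \<theta>_def scaleR_conv_of_real field_simps)
qed

text \<open>The amplitude condition on \<open>C\<close> makes the derivative of \<open>T\<close>
  equal to that of \<open>k * tanh (k * x + A)\<close>, and \<open>y\<close> makes the values at 0
  agree. Then \<open>f' = - T f\<close>, and the limit of \<open>T\<close> is
  \<open>k\<close>.\<close>

lemma sech_imp_residual_zero:
  assumes k: "0 < k" and y: "y = k * tanh A" and C: "(norm C)\<^sup>2 = 2 * r * k\<^sup>2"
    and fC: "\<And>x. 0 \<le> x \<Longrightarrow> f x = C / complex_of_real (cosh (k * x + A))"
  shows "integral {0..} (\<lambda>x. (norm (g x + T x *\<^sub>R f x))\<^sup>2) = 0" "\<kappa> = k"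
proof -
  have pos: "cosh (k * x + A) > 0" for x :: real by (rule cosh_real_pos)
  have nz: "cosh (k * x + A) \<noteq> 0" for x :: real using pos[of x] by simp
  define h where "h = (\<lambda>x. - ((k * tanh (k * x + A)) *\<^sub>R f x))"
  have Q: "(norm (f x))\<^sup>2 / (2 * r) = k\<^sup>2 * (1 - (tanh (k * x + A))\<^sup>2)" if "0 \<le> x" for x
  proof -
    have "1 - (tanh (k * x + A))\<^sup>2 = ((cosh (k * x + A))\<^sup>2 - (sinh (k * x + A))\<^sup>2) / (cosh (k * x + A))\<^sup>2"
      using nz[of x] by (simp add: tanh_def power_divide diff_divide_distrib)
    also have "\<dots> = 1 / (cosh (k * x + A))\<^sup>2"
      by (simp only: hyperbolic_pythagoras)
    finally show ?thesis
      using r by (simp add: fC[OF that] norm_divide power_divide C)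
  qed
  have dtanh: "((\<lambda>x. k * tanh (k * x + A)) has_real_derivative k\<^sup>2 * (1 - (tanh (k * x + A))\<^sup>2)) (at x within S)" for x S
    using nz[of x] by (auto intro!: derivative_eq_intros simp: power2_eq_square algebra_simps)
  have Teq: "T x = k * tanh (k * x + A)" if "0 \<le> x" for x
  proof -
    have "((\<lambda>x. T x - k * tanh (k * x + A)) has_vector_derivative 0) (at x within {0..})" if "x \<in> {0..}" for x
      using DERIV_diff[OF T_deriv[of x] dtanh[of x "{0..}"]] Q[of x] that
      by (simp add: has_real_derivative_iff_has_vector_derivative)
    then obtain c where "\<And>x. x \<in> {0..} \<Longrightarrow> T x - k * tanh (k * x + A) = c"
      using has_vector_derivative_zero_constant[of "{0..}" "\<lambda>x. T x - k * tanh (k * x + A)"] by auto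
    note c = this
    have "c = 0" using c[of 0] unfolding T_0 by (simp flip: y)
    then show ?thesis using c[of x] that by simp
  qed
  have "((\<lambda>x. k * tanh (k * x + A)) \<longlongrightarrow> k * 1) at_top"
  proof (intro tendsto_intros filterlim_compose[OF tanh_real_at_top])
    show "filterlim (\<lambda>x. k * x + A) at_top at_top"
      using filterlim_tendsto_add_at_top[OF tendsto_const
          filterlim_tendsto_pos_mult_at_top[OF tendsto_const k filterlim_ident], of A]
      by (simp add: add.commute)
  qed
  moreover have "\<forall>\<^sub>F x in at_top. k * tanh (k * x + A) = T x"
    using eventually_ge_at_top[of 0] by eventually_elim (simp add: Teq)
  ultimately have "(T \<longlongrightarrow> k) at_top"
    by (auto intro: Lim_transform_eventually)
  then show "\<kappa> = k"
    using tendsto_unique[OF _ T_tendsto] by simp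
  have df: "(f has_vector_derivative h x) (at x within {0..})" if x: "0 \<le> x" for x
  proof -
    have d: "((\<lambda>x. inverse (cosh (k * x + A))) has_real_derivative - (k * tanh (k * x + A)) * inverse (cosh (k * x + A))) (at x within {0..})"
      using nz[of x] by (auto intro!: derivative_eq_intros simp: tanh_def field_simps)
    have "((\<lambda>x. inverse (cosh (k * x + A)) *\<^sub>R C) has_vector_derivative
       (- (k * tanh (k * x + A)) * inverse (cosh (k * x + A))) *\<^sub>R C) (at x within {0..})"
      using has_vector_derivative_scaleR[OF d has_vector_derivative_const[of C]] by simp
    also have "(- (k * tanh (k * x + A)) * inverse (cosh (k * x + A))) *\<^sub>R C = h x"
      unfolding h_def fC[OF x] by (simp add: scaleR_conv_of_real field_simps)
    finally have D: "((\<lambda>x. inverse (cosh (k * x + A)) *\<^sub>R C) has_vector_derivative h x) (at x within {0..})" .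
    show ?thesis
      by (rule has_vector_derivative_transform[OF _ _ D])
        (use x fC in \<open>auto simp: scaleR_conv_of_real field_simps\<close>)
  qed
  have "continuous_on {0..} (\<lambda>x. k * tanh (k * x + A))"
    by (rule DERIV_continuous_on[OF dtanh])
  then have "ac_deriv f h"
    by (intro ac_deriv_of_vector_derivative df) (auto simp: h_def intro!: continuous_intros f_cont)
  \<comment> \<open>\<open>g\<close> and the explicit derivative \<open>h\<close> belong to the same
    \<open>f\<close>, so they agree almost everywhere.\<close>
  then have "negligible {x. 0 \<le> x \<and> g x \<noteq> h x}"
    by (rule ac_deriv_unique[OF ac])
  then have "integral {0..} (\<lambda>x. (norm (g x + T x *\<^sub>R f x))\<^sup>2) = integral {0..} (\<lambda>x::real. 0)"
    by (rule integral_spike) (auto simp: h_def Teq)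
  then show "integral {0..} (\<lambda>x. (norm (g x + T x *\<^sub>R f x))\<^sup>2) = 0"
    by simp
qed

end

section \<open>Membership of the hyperbolic secant profile in H1\<close>

lemma exp_decay_imp_L2_half_line:
  assumes "continuous_on {0..} f" "0 < k" "\<And>x. 0 \<le> x \<Longrightarrow> norm (f x) \<le> M * exp (- k * x)"
  shows "f \<in> L2_half_line"
proof -
  have 1: "f \<in> borel_measurable half_line"
    by (rule continuous_imp_measurable_on_sets_lebesgue[OF assms(1)]) auto
  have "(\<lambda>x. (norm (f x))\<^sup>2) absolutely_integrable_on {0..}"
  proof (rule measurable_bounded_by_integrable_imp_absolutely_integrable)
    show "(\<lambda>x. (norm (f x))\<^sup>2) \<in> borel_measurable half_line"
      using 1 by measurable
    have "(\<lambda>x. exp (- (2 * k) * x)) integrable_on {0..}"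
      using assms(2) by (intro integrable_on_exp_minus_to_infinity) simp
    then show "(\<lambda>x. M\<^sup>2 * exp (- (2 * k) * x)) integrable_on {0..}"
      by (rule integrable_on_mult_right)
    fix x :: real assume "x \<in> {0..}"
    then have "(norm (f x))\<^sup>2 \<le> (M * exp (- k * x))\<^sup>2"
      using assms(3) by (intro power_mono) auto
    also have "\<dots> = M\<^sup>2 * exp (- (2 * k) * x)"
      by (simp add: power_mult_distrib flip: exp_double)
    finally show "norm ((norm (f x))\<^sup>2) \<le> M\<^sup>2 * exp (- (2 * k) * x)" by simp
  qed auto
  then show ?thesis
    using 1 half_line_integral(1) by (auto simp: L2_half_line_def)
qed

lemma sech_in_H1_half_line:
  assumes k: "0 < k"
  shows "(\<lambda>x\<in>{0..}. C / complex_of_real (cosh (k * x + A))) \<in> H1_half_line"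
proof -
  define f where "f = (\<lambda>x. inverse (cosh (k * x + A)) *\<^sub>R C)"
  define g where "g = (\<lambda>x. (- (k * tanh (k * x + A)) * inverse (cosh (k * x + A))) *\<^sub>R C)"
  define F where "F = (\<lambda>x\<in>{0..}. C / complex_of_real (cosh (k * x + A)))"
  have pos: "cosh (k * x + A) > 0" for x :: real by (rule cosh_real_pos)
  have nz: "cosh (k * x + A) \<noteq> 0" for x :: real using pos[of x] by simp
  have Ff: "F x = f x" if "0 \<le> x" for x
    using that by (simp add: F_def f_def scaleR_conv_of_real field_simps)
  have df: "(f has_vector_derivative g x) (at x within {0..})" for x
  proof -
    have d: "((\<lambda>x. inverse (cosh (k * x + A))) has_real_derivative - (k * tanh (k * x + A)) * inverse (cosh (k * x + A))) (at x within {0..})"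
      using nz[of x] by (auto intro!: derivative_eq_intros simp: tanh_def field_simps)
    show ?thesis
      unfolding f_def g_def
      using has_vector_derivative_scaleR[OF d has_vector_derivative_const[of C]] by simp
  qed
  have dF: "(F has_vector_derivative g x) (at x within {0..})" if "0 \<le> x" for x
    by (rule has_vector_derivative_transform[OF _ _ df]) (use that Ff in auto)
  have cg: "continuous_on {0..} g"
    unfolding g_def using nz by (intro continuous_intros) auto
  have ac: "ac_deriv F g"
    by (rule ac_deriv_of_vector_derivative[OF dF cg])
  \<comment> \<open>From \<open>cosh t \<ge> exp t / 2\<close>; it also controls \<open>g\<close>,
    where the extra factor \<open>tanh\<close> is bounded by 1.\<close>
  have decay: "inverse (cosh (k * x + A)) \<le> 2 * exp (- A) * exp (- k * x)" for x
  proof -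
    have "exp (k * x + A) / 2 \<le> cosh (k * x + A)"
      by (simp add: cosh_field_def)
    then have "inverse (cosh (k * x + A)) \<le> inverse (exp (k * x + A) / 2)"
      by (rule le_imp_inverse_le) simp
    then show ?thesis by (simp add: exp_minus exp_add field_simps)
  qed
  have F2: "F \<in> L2_half_line"
  proof (rule exp_decay_imp_L2_half_line[OF ac_deriv_continuous_on[OF ac] k])
    fix x :: real assume "0 \<le> x"
    then show "norm (F x) \<le> (2 * exp (- A) * norm C) * exp (- k * x)"
      using mult_right_mono[OF decay[of x] norm_ge_zero[of C]] pos[of x] by (simp add: Ff f_def mult_ac)
  qed
  have g2: "g \<in> L2_half_line"
  proof (rule exp_decay_imp_L2_half_line[OF cg k])
    fix x :: real
    have "norm (g x) = (k * \<bar>tanh (k * x + A)\<bar>) * (inverse (cosh (k * x + A)) * norm C)"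
      using pos[of x] k by (simp add: g_def abs_mult)
    also have "\<dots> \<le> (k * 1) * (2 * exp (- A) * exp (- k * x) * norm C)"
      using k pos[of x] decay[of x] abs_le_iff tanh_real_bounds[of "k * x + A"]
      by (intro mult_mono) (auto simp: abs_le_iff intro: less_imp_le)
    finally show "norm (g x) \<le> (k * (2 * exp (- A) * norm C)) * exp (- k * x)"
      by (simp add: mult_ac)
  qed
  show ?thesis
    unfolding H1_half_line_def F_def[symmetric]
    using ac_deriv_continuous_on[OF ac] F2 g2 ac_deriv_imp_weak_derivative[OF ac]
    by (auto simp: F_def)
qed

section \<open>Ground states on the star graph\<close>

lemma tanh_artanh_real:
  fixes x :: real
  assumes "\<bar>x\<bar> < 1"
  shows "tanh (artanh x) = x"
proof -
  have e: "exp (- 2 * artanh x) = (1 - x) / (1 + x)"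
    using assms by (simp add: artanh_def exp_minus field_simps abs_less_iff)
  have "1 - (1 - x) / (1 + x) = 2 * x / (1 + x)" "1 + (1 - x) / (1 + x) = 2 / (1 + x)"
    using assms by (simp_all add: field_simps abs_less_iff)
  note frac = this
  have "tanh (artanh x) = (2 * x / (1 + x)) / (2 / (1 + x))"
    unfolding tanh_real_altdef e frac ..
  also have "\<dots> = x"
    using assms by (simp add: abs_less_iff)
  finally show ?thesis .
qed

lemma H1_graphD:
  assumes "u \<in> H1_graph N" "e \<in> {1..N}"
  shows "u e \<in> H1_half_line" "u e 0 = u 1 0"
  using assms unfolding H1_graph_def PiE_iff by blast+

lemma Lp_norm_power:
  assumes "0 < p"
  shows "Lp_norm N p u ^ p = (\<Sum>e=1..N. LINT x|half_line. norm (u e x) ^ p)"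
  unfolding Lp_norm_def using assms by (intro real_root_pow_pos2 sum_nonneg integral_nonneg) auto

text \<open>The energy of one component with cubic coefficient \<open>1 / r\<close>. Multiplying a
  function by \<open>sqrt r\<close> turns the energy for coefficient 1 into \<open>r\<close> times
  itself, which explains the factor \<open>r\<close> in the bounds below.\<close>

definition scalar_energy :: "nat \<Rightarrow> real \<Rightarrow> real \<Rightarrow> (nat \<Rightarrow> real \<Rightarrow> complex) \<Rightarrow> real" where
  "scalar_energy N \<gamma> r u = (\<Sum>e=1..N. LINT x|half_line. (norm (weak_deriv (u e) x))\<^sup>2)
     - \<gamma> * (norm (u 1 0))\<^sup>2 - (\<Sum>e=1..N. LINT x|half_line. norm (u e x) ^ 4) / (2 * r)"

lemma half_line_H1I: "0 < r \<Longrightarrow> f \<in> H1_half_line \<Longrightarrow> half_line_H1 f (weak_deriv f) r"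
  by unfold_locales (auto dest: H1_half_lineD)

lemma H1_half_line_absolutely_integrable:
  assumes "f \<in> H1_half_line"
  shows "(\<lambda>x. norm (f x) ^ 2) absolutely_integrable_on {0..}"
    "(\<lambda>x. norm (f x) ^ 4) absolutely_integrable_on {0..}"
    "(\<lambda>x. norm (weak_deriv f x) ^ 2) absolutely_integrable_on {0..}"
proof -
  interpret half_line_H1 f "weak_deriv f" 1 0
    by (rule half_line_H1I) (use assms in auto)
  show "(\<lambda>x. norm (f x) ^ 2) absolutely_integrable_on {0..}"
    "(\<lambda>x. norm (f x) ^ 4) absolutely_integrable_on {0..}"
    "(\<lambda>x. norm (weak_deriv f x) ^ 2) absolutely_integrable_on {0..}"
    by (rule Q_ai quartic_ai g2_ai)+
qed

text \<open>The functions \<^const>\<open>half_line_H1.T\<close> on the edges are all normalised to tend to the same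
  \<open>sqrt \<omega>\<close> at infinity. Their values at the vertex then add up to \<open>\<gamma>\<close>, which is exactly what cancels
  the delta interaction.\<close>

locale star_graph =
  fixes N :: nat and \<gamma> \<omega> :: real
  assumes N: "N \<ge> 2" and \<gamma>: "\<gamma> > 0" and \<omega>: "\<omega> > \<gamma>\<^sup>2 / (real N)\<^sup>2"
    and small: "real N * sqrt \<omega> - \<gamma> \<le> 2 * \<gamma> / real N"
begin

definition k :: real where "k = sqrt \<omega>"
text \<open>The value at the vertex of \<open>T\<close> on each edge of the symmetric state.\<close>

definition y0 :: real where "y0 = \<gamma> / real N"
text \<open>Half the mass of \<open>Phi\<close>.\<close>

definition m :: real where "m = real N * sqrt \<omega> - \<gamma>"
definition A :: real where "A = artanh (\<gamma> / (real N * sqrt \<omega>))"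
text \<open>The scalar energy of \<open>Phi\<close> for \<open>r = 1\<close>.\<close>

definition ground :: real where "ground = - (2 / 3) * (real N * (k ^ 3 - y0 ^ 3))"

section \<open>Relations between the parameters\<close>

lemma N_pos: "real N > 0" using N by simp

lemma y0_pos: "y0 > 0" using N_pos \<gamma> by (simp add: y0_def)

lemma y0_less_k: "y0 < k"
proof -
  have "y0\<^sup>2 < \<omega>" using \<omega> by (simp add: y0_def power_divide)
  then show ?thesis using real_less_rsqrt k_def by simp
qed

lemma k_pos: "k > 0" using y0_pos y0_less_k by linarith

lemma m_eq: "m = real N * (k - y0)"
  using N_pos by (simp add: m_def k_def y0_def algebra_simps)

lemma m_le: "m \<le> 2 * y0"
  using small by (simp add: m_def y0_def)

lemma tanh_A: "y0 = k * tanh A"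
proof -
  have "\<gamma> / (real N * sqrt \<omega>) = y0 / k" by (simp add: y0_def k_def)
  moreover have "\<bar>y0 / k\<bar> < 1" using y0_pos y0_less_k by simp
  ultimately have "tanh A = y0 / k" by (simp add: A_def tanh_artanh_real)
  then show ?thesis using k_pos by simp
qed

lemma phi_eq: "phi N \<omega> \<gamma> x = sqrt 2 * k / cosh (k * x + A)"
  using k_pos by (simp add: phi_def A_def real_sqrt_mult flip: k_def)

lemma graph_scale_Phi_apply:
  assumes "e \<in> {1..N}"
  shows "graph_scale N z (Phi N \<omega> \<gamma>) e = (\<lambda>x\<in>{0..}. (z * complex_of_real (sqrt 2 * k)) / complex_of_real (cosh (k * x + A)))"
  using assms by (auto simp: graph_scale_def Phi_def phi_eq fun_eq_iff restrict_def)

text \<open>The total increase of \<open>T\<close> along the edge; under the mass constraint these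
  increases add up to \<open>m\<close>.\<close>

definition edge_mass :: "real \<Rightarrow> (nat \<Rightarrow> real \<Rightarrow> complex) \<Rightarrow> nat \<Rightarrow> real" where
  "edge_mass r u e = integral {0..} (\<lambda>x. (norm (u e x))\<^sup>2) / (2 * r)"

text \<open>The starting value \<open>k - edge_mass r u e\<close> is the one for which
  \<open>T\<close> tends to \<open>k\<close>.\<close>

definition residual :: "real \<Rightarrow> (nat \<Rightarrow> real \<Rightarrow> complex) \<Rightarrow> nat \<Rightarrow> real" where
  "residual r u e = integral {0..} (\<lambda>x. (norm (weak_deriv (u e) x
     + half_line_H1.T (u e) r (k - edge_mass r u e) x *\<^sub>R u e x))\<^sup>2)"

text \<open>Valid for every \<open>u\<close>: the integral is 0 by default if the integrand is not
  integrable.\<close>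

lemma residual_nonneg: "residual r u e \<ge> 0"
  unfolding residual_def
  by (metis (mono_tags, lifting) Henstock_Kurzweil_Integration.integral_nonneg not_integrable_integral order_refl zero_le_power2)

text \<open>The calibration identities are summed over the edges. The starting values add up to
  \<gamma>, so the vertex terms cancel, and the cubes are expanded about their mean
  \<open>y0\<close>. Positivity of the last factor is where the smallness of the mass
  enters.\<close>

lemma scalar_energy_eq:
  assumes r: "0 < r" and u: "u \<in> H1_graph N"
    and mass: "(\<Sum>e=1..N. LINT x|half_line. (norm (u e x))\<^sup>2) = 2 * r * m"
  shows "scalar_energy N \<gamma> r u = r * ground + (\<Sum>e=1..N. residual r u e
     + 2 * r / 3 * ((k - edge_mass r u e - y0)\<^sup>2 * (k - edge_mass r u e + 2 * y0)))"
    and "e \<in> {1..N} \<Longrightarrow> 0 < k - edge_mass r u e + 2 * y0"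
proof -
  define y where "y = (\<lambda>e. k - edge_mass r u e)"
  note D = H1_half_line_absolutely_integrable[OF H1_graphD(1)[OF u]]
  have em: "edge_mass r u e = (LINT x|half_line. (norm (u e x))\<^sup>2) / (2 * r)" if "e \<in> {1..N}" for e
    using half_line_integral(2)[OF D(1)[OF that]] by (simp add: edge_mass_def)
  have em_sum: "(\<Sum>e=1..N. edge_mass r u e) = m"
    using mass r by (simp add: em flip: sum_divide_distrib)
  have em_nonneg: "edge_mass r u e \<ge> 0" if "e \<in> {1..N}" for e
    using r unfolding em[OF that] by (intro divide_nonneg_pos integral_nonneg) auto
  have sum_y: "(\<Sum>e=1..N. y e) = real N * y0"
    using em_sum m_eq by (simp add: y_def sum_subtractf algebra_simps)
  have id: "(LINT x|half_line. (norm (weak_deriv (u e) x))\<^sup>2) - (LINT x|half_line. norm (u e x) ^ 4) / (2 * r)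
     = residual r u e + y e * (norm (u 1 0))\<^sup>2 - 2 * r / 3 * (k ^ 3 - y e ^ 3)" if e: "e \<in> {1..N}" for e
  proof -
    interpret half_line_H1 "u e" "weak_deriv (u e)" r "y e"
      by (rule half_line_H1I[OF r H1_graphD(1)[OF u e]])
    have "\<kappa> = k" unfolding \<kappa>_def by (simp add: y_def edge_mass_def)
    then show ?thesis
      using calibration(2) H1_graphD(2)[OF u e]
      unfolding half_line_integral(2)[OF D(2)[OF e]] half_line_integral(2)[OF D(3)[OF e]]
      by (simp add: residual_def y_def)
  qed
  \<comment> \<open>The cube minus its tangent at \<open>y0\<close> has the double root
    \<open>y0\<close> and the simple root \<open>- 2 * y0\<close>. The tangent's linear term
    disappears in the sum because \<open>y0\<close> is the mean.\<close>
  have cube: "Y ^ 3 = (Y - y0)\<^sup>2 * (Y + 2 * y0) + y0 ^ 3 + 3 * y0\<^sup>2 * (Y - y0)" for Y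
    by (simp add: algebra_simps power2_eq_square power3_eq_cube)
  have cubes: "(\<Sum>e=1..N. k ^ 3 - y e ^ 3) = real N * (k ^ 3 - y0 ^ 3) - (\<Sum>e=1..N. (y e - y0)\<^sup>2 * (y e + 2 * y0))"
    unfolding cube[of "y _"]
    by (simp only: sum_subtractf sum.distrib sum_distrib_left[symmetric] sum_y sum_constant)
      (simp add: algebra_simps)
  have "scalar_energy N \<gamma> r u = (\<Sum>e=1..N. (LINT x|half_line. (norm (weak_deriv (u e) x))\<^sup>2)
       - (LINT x|half_line. norm (u e x) ^ 4) / (2 * r)) - \<gamma> * (norm (u 1 0))\<^sup>2"
    by (simp add: scalar_energy_def sum_subtractf sum_divide_distrib)
  also have "\<dots> = (\<Sum>e=1..N. residual r u e + y e * (norm (u 1 0))\<^sup>2 - 2 * r / 3 * (k ^ 3 - y e ^ 3)) - \<gamma> * (norm (u 1 0))\<^sup>2"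
    by (simp only: sum.cong[OF refl id])
  also have "\<dots> = (\<Sum>e=1..N. residual r u e) + (\<Sum>e=1..N. y e) * (norm (u 1 0))\<^sup>2
      - 2 * r / 3 * (\<Sum>e=1..N. k ^ 3 - y e ^ 3) - \<gamma> * (norm (u 1 0))\<^sup>2"
    unfolding sum_distrib_left sum_distrib_right by (simp only: sum_subtractf sum.distrib)
  also have "\<dots> = r * ground + ((\<Sum>e=1..N. residual r u e) + 2 * r / 3 * (\<Sum>e=1..N. (y e - y0)\<^sup>2 * (y e + 2 * y0)))"
    unfolding sum_y cubes ground_def using N_pos by (simp add: y0_def algebra_simps)
  finally show "scalar_energy N \<gamma> r u = r * ground + (\<Sum>e=1..N. residual r u e
     + 2 * r / 3 * ((k - edge_mass r u e - y0)\<^sup>2 * (k - edge_mass r u e + 2 * y0)))"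
    by (simp only: sum.distrib sum_distrib_left y_def)
  assume e: "e \<in> {1..N}"
  \<comment> \<open>A single edge carries at most the total, and
    \<open>m \<le> 2 * y0\<close>.\<close>
  have "edge_mass r u e \<le> m"
    unfolding em_sum[symmetric] using e em_nonneg by (intro member_le_sum) auto
  then show "0 < k - edge_mass r u e + 2 * y0"
    using m_le k_pos by linarith
qed

lemma scalar_energy_ge:
  assumes "0 < r" "u \<in> H1_graph N" "(\<Sum>e=1..N. LINT x|half_line. (norm (u e x))\<^sup>2) = 2 * r * m"
  shows "r * ground \<le> scalar_energy N \<gamma> r u"
proof -
  have nonneg: "0 \<le> residual r u e + 2 * r / 3 * ((k - edge_mass r u e - y0)\<^sup>2 * (k - edge_mass r u e + 2 * y0))"
    if "e \<in> {1..N}" for e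
    by (rule add_nonneg_nonneg[OF residual_nonneg])
      (use assms(1) scalar_energy_eq(2)[OF assms that] in simp)
  then show ?thesis
    unfolding scalar_energy_eq(1)[OF assms] using sum_nonneg[of "{1..N}", OF nonneg] by simp
qed

text \<open>In the equality case every residual and every cubic defect vanishes, so all starting
  values equal \<open>y0\<close> and each edge carries the same profile. Only the phase of the
  vertex value remains free.\<close>

lemma scalar_energy_eq_imp:
  assumes r: "0 < r" and u: "u \<in> H1_graph N"
    and mass: "(\<Sum>e=1..N. LINT x|half_line. (norm (u e x))\<^sup>2) = 2 * r * m"
    and eq: "scalar_energy N \<gamma> r u = r * ground"
  obtains \<theta> where "u = graph_scale N (exp (\<i> * complex_of_real \<theta>) * complex_of_real (sqrt r)) (Phi N \<omega> \<gamma>)"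
proof -
  note pos = scalar_energy_eq(2)[OF r u mass]
  let ?t = "\<lambda>e. residual r u e + 2 * r / 3 * ((k - edge_mass r u e - y0)\<^sup>2 * (k - edge_mass r u e + 2 * y0))"
  have t0: "0 \<le> 2 * r / 3 * ((k - edge_mass r u e - y0)\<^sup>2 * (k - edge_mass r u e + 2 * y0))" if "e \<in> {1..N}" for e
    using r pos[OF that] by simp
  have "(\<Sum>e=1..N. ?t e) = 0"
    using eq scalar_energy_eq(1)[OF r u mass] by simp
  then have "?t e = 0" if "e \<in> {1..N}" for e
    using that t0 residual_nonneg by (subst (asm) sum_nonneg_eq_0_iff) (auto intro: add_nonneg_nonneg)
  then have res0: "residual r u e = 0"
    and def0: "2 * r / 3 * ((k - edge_mass r u e - y0)\<^sup>2 * (k - edge_mass r u e + 2 * y0)) = 0"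
    if "e \<in> {1..N}" for e
    using t0[OF that] residual_nonneg[of r u e] that by (smt (verit))+
  have y: "k - edge_mass r u e = y0" if "e \<in> {1..N}" for e
    using def0[OF that] r pos[OF that] by simp
  define z where "z = u 1 0"
  have profile: "u e x = z * complex_of_real (cosh A) / complex_of_real (cosh (k * x + A))"
    and norm_z: "(norm z)\<^sup>2 = 2 * r * (k\<^sup>2 - y0\<^sup>2)"
    if e: "e \<in> {1..N}" and x: "0 \<le> x" for e x
  proof -
    interpret half_line_H1 "u e" "weak_deriv (u e)" r y0
      by (rule half_line_H1I[OF r H1_graphD(1)[OF u e]])
    have \<kappa>: "\<kappa> = k" using y[OF e] by (simp add: \<kappa>_def edge_mass_def)
    have res: "integral {0..} (\<lambda>x. (norm (weak_deriv (u e) x + T x *\<^sub>R u e x))\<^sup>2) = 0"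
      using res0[OF e] by (simp add: residual_def y[OF e])
    note R = residual_zero_imp_sech[OF res, unfolded \<kappa>, OF tanh_A]
    show "u e x = z * complex_of_real (cosh A) / complex_of_real (cosh (k * x + A))"
      using R(1)[OF x] H1_graphD(2)[OF u e] by (simp add: z_def)
    show "(norm z)\<^sup>2 = 2 * r * (k\<^sup>2 - y0\<^sup>2)"
      using R(2) H1_graphD(2)[OF u e] by (simp add: z_def)
  qed
  \<comment> \<open>The constant ratio of \<open>u\<close> to \<open>Phi\<close>, read off at the
    vertex.\<close>
  define c where "c = z * complex_of_real (cosh A) / complex_of_real (sqrt 2 * k)"
  have cosh_nz: "cosh A \<noteq> 0" using cosh_real_pos[of A] by linarith
  have "(norm z)\<^sup>2 = 2 * r * (k\<^sup>2 - y0\<^sup>2)"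
    by (rule norm_z[of 1 0]) (use N in auto)
  \<comment> \<open>With \<open>y0 = k * tanh A\<close> this becomes
    \<open>k\<^sup>2 / (cosh A)\<^sup>2\<close>, which gives \<open>c\<close> the modulus
    \<open>sqrt r\<close>.\<close>
  also have "k\<^sup>2 - y0\<^sup>2 = k\<^sup>2 * ((cosh A)\<^sup>2 - (sinh A)\<^sup>2) / (cosh A)\<^sup>2"
    unfolding tanh_A using cosh_nz by (simp add: tanh_def field_simps)
  also have "\<dots> = k\<^sup>2 / (cosh A)\<^sup>2" by (simp only: hyperbolic_pythagoras mult_1_right)
  finally have "(norm c)\<^sup>2 = r"
    unfolding c_def using cosh_nz k_pos
    by (simp add: norm_mult norm_divide power_mult_distrib power_divide field_simps)
  then have norm_c: "norm c = sqrt r"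
    by (metis norm_ge_zero real_sqrt_unique)
  then have "c \<noteq> 0" using r by auto
  then have c_eq: "c = exp (\<i> * complex_of_real (Arg c)) * complex_of_real (sqrt r)"
    using Arg_eq[of c] norm_c by (simp add: mult.commute)
  have "u = graph_scale N c (Phi N \<omega> \<gamma>)"
  proof (rule PiE_ext)
    show "u \<in> {1..N} \<rightarrow>\<^sub>E UNIV" using u unfolding H1_graph_def PiE_iff by blast
    show "graph_scale N c (Phi N \<omega> \<gamma>) \<in> {1..N} \<rightarrow>\<^sub>E UNIV" by (simp add: graph_scale_def)
    fix e assume e: "e \<in> {1..N}"
    show "u e = graph_scale N c (Phi N \<omega> \<gamma>) e"
    proof (rule extensionalityI)
      show "u e \<in> extensional {0..}" by (rule H1_half_lineD(1)[OF H1_graphD(1)[OF u e]])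
      show "graph_scale N c (Phi N \<omega> \<gamma>) e \<in> extensional {0..}"
        by (simp add: graph_scale_Phi_apply[OF e])
      fix x :: real assume "x \<in> {0..}"
      then show "u e x = graph_scale N c (Phi N \<omega> \<gamma>) e x"
        using profile[OF e, of x] k_pos by (simp add: graph_scale_Phi_apply[OF e] c_def)
    qed
  qed
  then show thesis using c_eq that by metis
qed

text \<open>On each edge the limit of \<open>T\<close> started at \<open>y0\<close> is
  \<open>k\<close>, which determines the mass without integrating the squared secant. All
  corrections to the energy then vanish.\<close>

lemma graph_scale_Phi:
  assumes r: "0 < r" and u_def: "u = graph_scale N (exp (\<i> * complex_of_real \<theta>) * complex_of_real (sqrt r)) (Phi N \<omega> \<gamma>)"
  shows "u \<in> H1_graph N"
    and "(\<Sum>e=1..N. LINT x|half_line. (norm (u e x))\<^sup>2) = 2 * r * m"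
    and "scalar_energy N \<gamma> r u = r * ground"
proof -
  define c where "c = exp (\<i> * complex_of_real \<theta>) * complex_of_real (sqrt r) * complex_of_real (sqrt 2 * k)"
  have ue: "u e = (\<lambda>x\<in>{0..}. c / complex_of_real (cosh (k * x + A)))" if "e \<in> {1..N}" for e
    unfolding u_def c_def by (rule graph_scale_Phi_apply[OF that])
  have norm_c: "(norm c)\<^sup>2 = 2 * r * k\<^sup>2"
    using r by (simp add: c_def norm_mult power_mult_distrib)
  show u: "u \<in> H1_graph N"
    unfolding H1_graph_def
  proof (intro CollectI conjI ballI)
    have "u \<in> extensional {1..N}" by (simp add: u_def graph_scale_def)
    then show "u \<in> {1..N} \<rightarrow>\<^sub>E H1_half_line"
      using sech_in_H1_half_line[OF k_pos] by (auto simp: PiE_iff ue)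
    show "u e 0 = u 1 0" if "e \<in> {1..N}" for e
      using ue[OF that] ue[of 1] N by simp
  qed
  have edge: "edge_mass r u e = k - y0" "residual r u e = 0"
    "(LINT x|half_line. (norm (u e x))\<^sup>2) = 2 * r * (k - y0)" if e: "e \<in> {1..N}" for e
  proof -
    interpret half_line_H1 "u e" "weak_deriv (u e)" r y0
      by (rule half_line_H1I[OF r H1_graphD(1)[OF u e]])
    have R: "integral {0..} (\<lambda>x. (norm (weak_deriv (u e) x + T x *\<^sub>R u e x))\<^sup>2) = 0" "\<kappa> = k"
      by (rule sech_imp_residual_zero[OF k_pos tanh_A norm_c]; simp add: ue[OF e])+
    show em: "edge_mass r u e = k - y0"
      using R(2) by (simp add: \<kappa>_def edge_mass_def)
    show "residual r u e = 0" using R(1) by (simp add: residual_def em)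
    show "(LINT x|half_line. (norm (u e x))\<^sup>2) = 2 * r * (k - y0)"
      using em r half_line_integral(2)[OF Q_ai] by (simp add: edge_mass_def field_simps)
  qed
  show mass: "(\<Sum>e=1..N. LINT x|half_line. (norm (u e x))\<^sup>2) = 2 * r * m"
    by (simp add: edge m_eq)
  show "scalar_energy N \<gamma> r u = r * ground"
    unfolding scalar_energy_eq(1)[OF r u mass] by (simp add: edge)
qed

text \<open>The relations for \<open>p\<close> and \<open>q\<close> allow the quartic part to be
  completed to a square in the two densities; kinetic and vertex terms already separate.\<close>

lemma energy_decomposition:
  assumes p: "0 < p" and q: "0 < q" and pq: "a * p + b * q = 1" "b * p + c * q = 1"
    and u: "u \<in> H1_graph N" and v: "v \<in> H1_graph N"
  shows "energy N \<gamma> a b c u v = scalar_energy N \<gamma> p u + scalar_energy N \<gamma> q v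
    + b / (2 * p * q) * (\<Sum>e=1..N. LINT x|half_line. (q * (norm (u e x))\<^sup>2 - p * (norm (v e x))\<^sup>2)\<^sup>2)"
proof -
  define U where "U = (\<Sum>e=1..N. LINT x|half_line. norm (u e x) ^ 4)"
  define V where "V = (\<Sum>e=1..N. LINT x|half_line. norm (v e x) ^ 4)"
  define W where "W = (\<Sum>e=1..N. LINT x|half_line. (norm (u e x * v e x))\<^sup>2)"
  have S: "(LINT x|half_line. (q * (norm (u e x))\<^sup>2 - p * (norm (v e x))\<^sup>2)\<^sup>2)
     = q\<^sup>2 * (LINT x|half_line. norm (u e x) ^ 4) + p\<^sup>2 * (LINT x|half_line. norm (v e x) ^ 4)
       - 2 * p * q * (LINT x|half_line. (norm (u e x * v e x))\<^sup>2)" if e: "e \<in> {1..N}" for e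
  proof -
    note iu = half_line_integral(1)[OF H1_half_line_absolutely_integrable(2)[OF H1_graphD(1)[OF u e]]]
    note iv = half_line_integral(1)[OF H1_half_line_absolutely_integrable(2)[OF H1_graphD(1)[OF v e]]]
    have [measurable]: "u e \<in> borel_measurable half_line" "v e \<in> borel_measurable half_line"
      using L2_half_lineD(1) H1_half_lineD(2) H1_graphD(1) u v e by blast+
    have iw: "integrable half_line (\<lambda>x. (norm (u e x * v e x))\<^sup>2)"
    proof (rule Bochner_Integration.integrable_bound[OF Bochner_Integration.integrable_add[OF iu iv]])
      show "AE x in half_line. norm ((norm (u e x * v e x))\<^sup>2) \<le> norm (norm (u e x) ^ 4 + norm (v e x) ^ 4)"
      proof (rule AE_I2)
        fix x
        have "2 * (norm (u e x))\<^sup>2 * (norm (v e x))\<^sup>2 \<le> ((norm (u e x))\<^sup>2)\<^sup>2 + ((norm (v e x))\<^sup>2)\<^sup>2"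
          by (rule sum_squares_bound)
        moreover have "0 \<le> (norm (u e x))\<^sup>2 * (norm (v e x))\<^sup>2" by simp
        moreover have "((norm (u e x))\<^sup>2)\<^sup>2 = norm (u e x) ^ 4" "((norm (v e x))\<^sup>2)\<^sup>2 = norm (v e x) ^ 4"
          by simp_all
        ultimately have "(norm (u e x))\<^sup>2 * (norm (v e x))\<^sup>2 \<le> norm (u e x) ^ 4 + norm (v e x) ^ 4"
          unfolding mult.assoc by linarith
        then show "norm ((norm (u e x * v e x))\<^sup>2) \<le> norm (norm (u e x) ^ 4 + norm (v e x) ^ 4)"
          by (simp add: norm_mult power_mult_distrib)
      qed
    qed measurable
    have "(LINT x|half_line. (q * (norm (u e x))\<^sup>2 - p * (norm (v e x))\<^sup>2)\<^sup>2)
      = (LINT x|half_line. q\<^sup>2 * norm (u e x) ^ 4 + p\<^sup>2 * norm (v e x) ^ 4 - 2 * p * q * (norm (u e x * v e x))\<^sup>2)"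
      by (intro Bochner_Integration.integral_cong refl)
        (simp add: power2_diff power_mult_distrib norm_mult algebra_simps flip: power_mult)
    also have "\<dots> = q\<^sup>2 * (LINT x|half_line. norm (u e x) ^ 4) + p\<^sup>2 * (LINT x|half_line. norm (v e x) ^ 4)
       - 2 * p * q * (LINT x|half_line. (norm (u e x * v e x))\<^sup>2)"
      using iu iv iw by simp
    finally show ?thesis .
  qed
  have Ssum: "(\<Sum>e=1..N. LINT x|half_line. (q * (norm (u e x))\<^sup>2 - p * (norm (v e x))\<^sup>2)\<^sup>2) = q\<^sup>2 * U + p\<^sup>2 * V - 2 * p * q * W"
    unfolding U_def V_def W_def sum_distrib_left sum.distrib[symmetric] sum_subtractf[symmetric]
    by (rule sum.cong[OF refl S])
  \<comment> \<open>Solving for \<open>a\<close> and \<open>c\<close> leaves \<open>b\<close>,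
    \<open>p\<close> and \<open>q\<close> as free parameters of the algebraic identity.\<close>
  have a: "a = (1 - b * q) / p" and c: "c = (1 - b * p) / q"
    using pq p q by (simp_all add: field_simps)
  have "b / (2 * p * q) * (q\<^sup>2 * U + p\<^sup>2 * V - 2 * p * q * W) = U / (2 * p) + V / (2 * q) - 1/2 * (a * U + c * V) - b * W"
    unfolding a c using p q by (simp add: field_simps power2_eq_square)
  then show ?thesis
    \<comment> \<open>The explicit \<open>num\<close> terms are the exponents 2 and 4.\<close>
    unfolding energy_def scalar_energy_def Ssum
      Lp_norm_power[OF zero_less_numeral, of N "num.Bit0 num.One"] Lp_norm_power[OF zero_less_numeral, of N "num.Bit0 (num.Bit0 num.One)"]
      U_def[symmetric] V_def[symmetric] W_def[symmetric]
    by (simp add: algebra_simps)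
qed

end

section \<open>Ground states of the coupled system\<close>

theorem theorem2p4:
  fixes N :: nat and \<gamma> a b c \<omega> \<alpha> \<beta> :: real
  assumes "N \<ge> 2" and "\<gamma> > 0"
    and "(0 < b \<and> b < min a c) \<or> (a > 0 \<and> c > 0 \<and> b > max a c)"
    and "\<omega> > \<gamma>\<^sup>2 / (real N)\<^sup>2"
    and "real N * sqrt \<omega> - \<gamma> \<le> 2 * \<gamma> / real N"
    and "\<alpha> = 2 * (b - c) / (b\<^sup>2 - a * c) * (real N * sqrt \<omega> - \<gamma>)"
    and "\<beta> = 2 * (b - a) / (b\<^sup>2 - a * c) * (real N * sqrt \<omega> - \<gamma>)"
  shows "ground_states N \<gamma> a b c \<alpha> \<beta> =
    {(graph_scale N (exp (\<i> * complex_of_real \<theta>\<^sub>1)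
         * complex_of_real (sqrt ((b - c) / (b\<^sup>2 - a * c)))) (Phi N \<omega> \<gamma>),
      graph_scale N (exp (\<i> * complex_of_real \<theta>\<^sub>2)
         * complex_of_real (sqrt ((b - a) / (b\<^sup>2 - a * c)))) (Phi N \<omega> \<gamma>)) | \<theta>\<^sub>1 \<theta>\<^sub>2 :: real. True}"
proof -
  interpret star_graph N \<gamma> \<omega> by unfold_locales (use assms in auto)
  define p where "p = (b - c) / (b\<^sup>2 - a * c)"
  define q where "q = (b - a) / (b\<^sup>2 - a * c)"
  have b: "b > 0" using assms(3) by auto
  \<comment> \<open>In either regime both numerators have the sign of the common denominator, so
    \<open>p\<close> and \<open>q\<close> are positive.\<close>
  have sgn: "(b - c > 0 \<and> b - a > 0 \<and> b\<^sup>2 - a * c > 0) \<or> (b - c < 0 \<and> b - a < 0 \<and> b\<^sup>2 - a * c < 0)"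
    using assms(3)
  proof
    assume h: "0 < b \<and> b < min a c"
    then have "b * b < a * c" by (intro mult_strict_mono) auto
    then show ?thesis using h by (simp add: power2_eq_square)
  next
    assume h: "a > 0 \<and> c > 0 \<and> b > max a c"
    then have "a * c < b * b" by (intro mult_strict_mono) auto
    then show ?thesis using h by (simp add: power2_eq_square)
  qed
  then have p: "p > 0" and q: "q > 0"
    by (auto simp: p_def q_def zero_less_divide_iff)
  have pq: "a * p + b * q = 1" "b * p + c * q = 1"
  proof -
    have "a * p + b * q = (a * (b - c) + b * (b - a)) / (b\<^sup>2 - a * c)"
      "b * p + c * q = (b * (b - c) + c * (b - a)) / (b\<^sup>2 - a * c)"
      by (simp_all add: p_def q_def add_divide_distrib)
    moreover have "a * (b - c) + b * (b - a) = b\<^sup>2 - a * c" "b * (b - c) + c * (b - a) = b\<^sup>2 - a * c"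
      by (simp_all add: algebra_simps power2_eq_square)
    moreover have "b\<^sup>2 - a * c \<noteq> 0" using sgn by auto
    ultimately show "a * p + b * q = 1" "b * p + c * q = 1" by (metis divide_self)+
  qed
  have \<alpha>: "\<alpha> = 2 * p * m" and \<beta>: "\<beta> = 2 * q * m"
    using assms(6,7) by (simp_all add: p_def q_def m_def)
  define P where "P = (\<lambda>\<theta>. graph_scale N (exp (\<i> * complex_of_real \<theta>) * complex_of_real (sqrt p)) (Phi N \<omega> \<gamma>))"
  define Q where "Q = (\<lambda>\<theta>. graph_scale N (exp (\<i> * complex_of_real \<theta>) * complex_of_real (sqrt q)) (Phi N \<omega> \<gamma>))"
  have cs: "(u, v) \<in> constraint_set N \<alpha> \<beta> \<longleftrightarrow> u \<in> H1_graph N \<and> v \<in> H1_graph N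
      \<and> (\<Sum>e=1..N. LINT x|half_line. (norm (u e x))\<^sup>2) = 2 * p * m
      \<and> (\<Sum>e=1..N. LINT x|half_line. (norm (v e x))\<^sup>2) = 2 * q * m" for u v
    unfolding constraint_set_def \<alpha> \<beta> Lp_norm_power[OF zero_less_numeral, of N "num.Bit0 num.One"] by simp
  define R where "R = (\<lambda>(u :: nat \<Rightarrow> real \<Rightarrow> complex) (v :: nat \<Rightarrow> real \<Rightarrow> complex). \<Sum>e=1..N. LINT x|half_line. (q * (norm (u e x))\<^sup>2 - p * (norm (v e x))\<^sup>2)\<^sup>2)"
  \<comment> \<open>Positivity of \<open>b\<close> makes the coupling defect nonnegative.\<close>
  have R: "b / (2 * p * q) * R u v \<ge> 0" for u v
    unfolding R_def using b p q by (intro mult_nonneg_nonneg sum_nonneg integral_nonneg) auto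
  have E: "energy N \<gamma> a b c u v = scalar_energy N \<gamma> p u + scalar_energy N \<gamma> q v + b / (2 * p * q) * R u v"
    if "u \<in> H1_graph N" "v \<in> H1_graph N" for u v
    unfolding R_def by (rule energy_decomposition[OF p q pq that])
  have parts: "p * ground \<le> scalar_energy N \<gamma> p u" "q * ground \<le> scalar_energy N \<gamma> q v"
    "scalar_energy N \<gamma> p u + scalar_energy N \<gamma> q v \<le> energy N \<gamma> a b c u v"
    if "(u, v) \<in> constraint_set N \<alpha> \<beta>" for u v
  proof -
    have uv: "u \<in> H1_graph N" "v \<in> H1_graph N" using that by (simp_all only: cs)
    show "p * ground \<le> scalar_energy N \<gamma> p u" "q * ground \<le> scalar_energy N \<gamma> q v"
      using that p q by (auto simp only: cs intro!: scalar_energy_ge)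
    show "scalar_energy N \<gamma> p u + scalar_energy N \<gamma> q v \<le> energy N \<gamma> a b c u v"
      using E[OF uv] R[of u v] by linarith
  qed
  have lower: "(p + q) * ground \<le> energy N \<gamma> a b c u v" if "(u, v) \<in> constraint_set N \<alpha> \<beta>" for u v
    using parts[OF that] unfolding distrib_right by linarith
  have in_cs: "(P \<theta>\<^sub>1, Q \<theta>\<^sub>2) \<in> constraint_set N \<alpha> \<beta>" for \<theta>\<^sub>1 \<theta>\<^sub>2
    unfolding cs using graph_scale_Phi(1,2)[OF p P_def[THEN fun_cong]] graph_scale_Phi(1,2)[OF q Q_def[THEN fun_cong]]
    by blast
  have attained: "energy N \<gamma> a b c (P \<theta>\<^sub>1) (Q \<theta>\<^sub>2) = (p + q) * ground" for \<theta>\<^sub>1 \<theta>\<^sub>2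
  proof -
    \<comment> \<open>The squared amplitudes are in the ratio \<open>p\<close> to \<open>q\<close>,
      so the coupling defect vanishes pointwise for all pairs of phases.\<close>
    have "q * (norm (P \<theta>\<^sub>1 e x))\<^sup>2 - p * (norm (Q \<theta>\<^sub>2 e x))\<^sup>2 = 0" if "e \<in> {1..N}" "x \<in> {0..}" for e x
      using that p q by (simp add: P_def Q_def graph_scale_def norm_mult power_mult_distrib)
    then have "R (P \<theta>\<^sub>1) (Q \<theta>\<^sub>2) = (\<Sum>e=1..N. LINT x|half_line. 0)"
      unfolding R_def by (intro sum.cong Bochner_Integration.integral_cong refl) auto
    moreover have "P \<theta>\<^sub>1 \<in> H1_graph N" "Q \<theta>\<^sub>2 \<in> H1_graph N"
      using in_cs[of \<theta>\<^sub>1 \<theta>\<^sub>2] by (simp_all add: cs)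
    ultimately show ?thesis
      using E[of "P \<theta>\<^sub>1" "Q \<theta>\<^sub>2"] graph_scale_Phi(3)[OF p P_def[THEN fun_cong, of \<theta>\<^sub>1]]
        graph_scale_Phi(3)[OF q Q_def[THEN fun_cong, of \<theta>\<^sub>2]]
      by (simp add: distrib_right)
  qed
  have J: "ground_energy N \<gamma> a b c \<alpha> \<beta> = ereal ((p + q) * ground)"
    unfolding ground_energy_def
  proof (rule antisym)
    show "(INF (u, v)\<in>constraint_set N \<alpha> \<beta>. ereal (energy N \<gamma> a b c u v)) \<le> ereal ((p + q) * ground)"
      by (rule INF_lower2[OF in_cs[of 0 0]]) (simp add: attained)
    show "ereal ((p + q) * ground) \<le> (INF (u, v)\<in>constraint_set N \<alpha> \<beta>. ereal (energy N \<gamma> a b c u v))"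
      by (rule INF_greatest) (auto intro: lower)
  qed
  have "ground_states N \<gamma> a b c \<alpha> \<beta> = {(P \<theta>\<^sub>1, Q \<theta>\<^sub>2) | \<theta>\<^sub>1 \<theta>\<^sub>2 :: real. True}"
  proof (intro subset_antisym subsetI)
    fix w assume "w \<in> ground_states N \<gamma> a b c \<alpha> \<beta>"
    then obtain u v where w: "w = (u, v)" and uv: "(u, v) \<in> constraint_set N \<alpha> \<beta>"
      and min: "energy N \<gamma> a b c u v = (p + q) * ground"
      by (auto simp: ground_states_def J)
    note cuv = uv[unfolded cs]
    \<comment> \<open>Both scalar energies are at least their minima and their sum is at most
      \<open>(p + q) * ground\<close>, so both are equalities.\<close>
    have "scalar_energy N \<gamma> p u = p * ground" "scalar_energy N \<gamma> q v = q * ground"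
      using parts[OF uv] min unfolding distrib_right by linarith+
    then obtain \<theta>\<^sub>1 \<theta>\<^sub>2 where "u = P \<theta>\<^sub>1" "v = Q \<theta>\<^sub>2"
      using scalar_energy_eq_imp[OF p, of u] scalar_energy_eq_imp[OF q, of v] cuv
      unfolding P_def Q_def by metis
    then show "w \<in> {(P \<theta>\<^sub>1, Q \<theta>\<^sub>2) | \<theta>\<^sub>1 \<theta>\<^sub>2 :: real. True}" using w by blast
  next
    fix w assume "w \<in> {(P \<theta>\<^sub>1, Q \<theta>\<^sub>2) | \<theta>\<^sub>1 \<theta>\<^sub>2 :: real. True}"
    then show "w \<in> ground_states N \<gamma> a b c \<alpha> \<beta>"
      using in_cs attained by (auto simp: ground_states_def J)
  qed
  then show ?thesis by (simp only: P_def Q_def p_def q_def)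
qed

end
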